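(* Let $\lambda,\mu$ be real constants, $\mathbf T=\mathbf R/(2\pi\mathbf Z)$, and let $w$ be a standard one-dimensional Wiener process. Let $\boldsymbol u=(u^{(1)},u^{(2)})$ be the solution, for $x\in\mathbf T$, $t\ge0$, of $$\begin{cases}du^{(1)}=u^{(1)}_{xx}\,dt+(\lambda u^{(1)}_x-\mu u^{(2)}_x)\,dw_t,\\ du^{(2)}=u^{(2)}_{xx}\,dt+(\mu u^{(1)}_x+\lambda u^{(2)}_x)\,dw_t,\end{cases}$$ with initial data $$u^{(1)}(x,0)+\sqrt{-1}\,u^{(2)}(x,0)=\sum_{n\in\mathbf Z}e^{-n^2}e^{\sqrt{-1}\,nx}.$$ Let $p>2$ and $\lambda^2+\mu^2<2$. If $\varepsilon:=\lambda^2+(p-1)\mu^2-2>0$, then $$\mathbb E\|\boldsymbol u(\cdot,t)\|^p_{L^2(\mathbf T)}=\infty\qquad\text{for any } t>2/\varepsilon.$$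
   Context: When $\lambda^2+\mu^2<2$, the system has a unique solution $\boldsymbol u$ belonging to $L^2(\Omega;C([0,T];H^m(\mathbf T)))$ for every $m\ge0$ and $T>0$ (a known fact); $\boldsymbol u$ denotes this solution. Here $H^m(\mathbf T)$ is the $L^2$-based Sobolev space and the system is understood in the Itô sense. *)

theory Defs
  imports "HOL-Probability.Probability"
begin

section \<open>Sobolev spaces on the torus\<close>

text \<open>
  Functions on the torus \<open>\<real>/2\<pi>\<int>\<close> are represented by \<open>2\<pi>\<close>-periodic functions on the
  real line, and integrals over the torus by integrals over one period.
\<close>

definition L2_torus :: "(real \<Rightarrow> real) set" where
  "L2_torus = {f. f \<in> borel_measurable borel \<and> (\<forall>x. f (x + 2 * pi) = f x) \<and>
                  set_integrable lborel {0..2 * pi} (\<lambda>x. (f x)\<^sup>2)}"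

definition torus_inner :: "(real \<Rightarrow> real) \<Rightarrow> (real \<Rightarrow> real) \<Rightarrow> real" where
  "torus_inner f g = (LINT x:{0..2 * pi}|lborel. f x * g x)"

definition L2_torus_norm :: "(real \<Rightarrow> real) \<Rightarrow> real" where
  "L2_torus_norm f = sqrt (torus_inner f f)"

definition smooth_torus :: "(real \<Rightarrow> real) set" where
  "smooth_torus = {\<phi>. (\<forall>x. \<phi> (x + 2 * pi) = \<phi> x) \<and>
                      (\<forall>k x. (deriv ^^ k) \<phi> differentiable (at x))}"

definition has_weak_deriv :: "nat \<Rightarrow> (real \<Rightarrow> real) \<Rightarrow> (real \<Rightarrow> real) \<Rightarrow> bool" where
  "has_weak_deriv k f g \<longleftrightarrow> f \<in> L2_torus \<and> g \<in> L2_torus \<and>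
     (\<forall>\<phi>\<in>smooth_torus. torus_inner f ((deriv ^^ k) \<phi>) = (-1) ^ k * torus_inner g \<phi>)"

text \<open>Weak derivatives are unique only almost everywhere; \<open>weak_deriv\<close> picks a representative.\<close>

definition weak_deriv :: "nat \<Rightarrow> (real \<Rightarrow> real) \<Rightarrow> (real \<Rightarrow> real)" where
  "weak_deriv k f = (SOME g. has_weak_deriv k f g)"

definition sobolev_torus :: "nat \<Rightarrow> (real \<Rightarrow> real) set" where
  "sobolev_torus m = {f. \<forall>k\<le>m. \<exists>g. has_weak_deriv k f g}"

definition sobolev_norm :: "nat \<Rightarrow> (real \<Rightarrow> real) \<Rightarrow> real" where
  "sobolev_norm m f = sqrt (\<Sum>k\<le>m. (L2_torus_norm (weak_deriv k f))\<^sup>2)"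

section \<open>Wiener process and Ito integral\<close>

locale filtered_prob_space = prob_space M + filtration "space M" F
  for M :: "'a measure" and F :: "real \<Rightarrow> 'a measure" +
  assumes subalgebra_F: "\<And>s. subalgebra M (F s)"

text \<open>
  The time index ranges over all reals because that is the index type of the library's
  filtrations, but only times \<open>t \<ge> 0\<close> matter.
\<close>

locale wiener_process = filtered_prob_space M F
  for M :: "'a measure" and F :: "real \<Rightarrow> 'a measure" +
  fixes w :: "real \<Rightarrow> 'a \<Rightarrow> real"
  assumes wiener_0: "AE \<omega> in M. w 0 \<omega> = 0"
    and wiener_adapted: "\<And>t. 0 \<le> t \<Longrightarrow> w t \<in> borel_measurable (F t)"
    and wiener_gaussian: "\<And>s t. 0 \<le> s \<Longrightarrow> s < t \<Longrightarrow>
          distributed M lborel (\<lambda>\<omega>. w t \<omega> - w s \<omega>)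
            (\<lambda>x. ennreal (normal_density 0 (sqrt (t - s)) x))"
    and wiener_indep: "\<And>s t. 0 \<le> s \<Longrightarrow> s < t \<Longrightarrow>
          indep_set (sets (F s))
            {(\<lambda>\<omega>. w t \<omega> - w s \<omega>) -` A \<inter> space M | A. A \<in> sets borel}"
    and wiener_continuous: "AE \<omega> in M. continuous_on {0..} (\<lambda>t. w t \<omega>)"

text \<open>
  A simple integrand on \<open>[0,T]\<close> is \<open>\<Sum>i<n. \<xi> i \<omega> * 1\<^bsub>(\<tau> i, \<tau> (i+1)]\<^esub>(s)\<close> for a partition
  \<open>0 = \<tau> 0 \<le> \<dots> \<le> \<tau> n = T\<close> and bounded \<open>F (\<tau> i)\<close>-measurable \<open>\<xi> i\<close>.
\<close>

definition simple_integrand ::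
  "(real \<Rightarrow> 'a measure) \<Rightarrow> real \<Rightarrow> nat \<Rightarrow> (nat \<Rightarrow> real) \<Rightarrow> (nat \<Rightarrow> 'a \<Rightarrow> real) \<Rightarrow> bool" where
  "simple_integrand F T n \<tau> \<xi> \<longleftrightarrow> \<tau> 0 = 0 \<and> \<tau> n = T \<and> (\<forall>i<n. \<tau> i \<le> \<tau> (Suc i)) \<and>
     (\<forall>i<n. \<xi> i \<in> borel_measurable (F (\<tau> i)) \<and>
            (\<exists>C. \<forall>\<omega>\<in>space (F (\<tau> i)). \<bar>\<xi> i \<omega>\<bar> \<le> C))"

definition simple_process ::
  "nat \<Rightarrow> (nat \<Rightarrow> real) \<Rightarrow> (nat \<Rightarrow> 'a \<Rightarrow> real) \<Rightarrow> real \<Rightarrow> 'a \<Rightarrow> real" where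
  "simple_process n \<tau> \<xi> s \<omega> = (\<Sum>i<n. \<xi> i \<omega> * indicator {\<tau> i<..\<tau> (Suc i)} s)"

definition simple_ito_integral ::
  "(real \<Rightarrow> 'a \<Rightarrow> real) \<Rightarrow> nat \<Rightarrow> (nat \<Rightarrow> real) \<Rightarrow> (nat \<Rightarrow> 'a \<Rightarrow> real) \<Rightarrow> 'a \<Rightarrow> real" where
  "simple_ito_integral w n \<tau> \<xi> \<omega> = (\<Sum>i<n. \<xi> i \<omega> * (w (\<tau> (Suc i)) \<omega> - w (\<tau> i) \<omega>))"

definition progressive :: "(real \<Rightarrow> 'a measure) \<Rightarrow> real \<Rightarrow> (real \<Rightarrow> 'a \<Rightarrow> real) \<Rightarrow> bool" where
  "progressive F T f \<longleftrightarrow> (\<forall>t\<in>{0..T}.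
     (\<lambda>(s, \<omega>). f s \<omega>) \<in> borel_measurable (restrict_space borel {0..t} \<Otimes>\<^sub>M F t))"

text \<open>
  \<open>J\<close> is (a version of) the Ito integral of \<open>f\<close> over \<open>[0,T]\<close>: there are simple integrands
  converging to \<open>f\<close> in \<open>L\<^sup>2(\<Omega> \<times> [0,T])\<close> whose integrals converge to \<open>J\<close> in \<open>L\<^sup>2(\<Omega>)\<close>.
  In particular \<open>f\<close> is square integrable on \<open>\<Omega> \<times> [0,T]\<close>. By the Ito isometry \<open>J\<close> is unique up
  to null sets and does not depend on the approximating sequence.
\<close>

definition has_ito_integral ::
  "'a measure \<Rightarrow> (real \<Rightarrow> 'a measure) \<Rightarrow> (real \<Rightarrow> 'a \<Rightarrow> real) \<Rightarrow> real \<Rightarrow>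
   (real \<Rightarrow> 'a \<Rightarrow> real) \<Rightarrow> ('a \<Rightarrow> real) \<Rightarrow> bool" where
  "has_ito_integral M F w T f J \<longleftrightarrow>
     progressive F T f \<and> J \<in> borel_measurable M \<and>
     (\<exists>n \<tau> \<xi>. (\<forall>k::nat. simple_integrand F T (n k) (\<tau> k) (\<xi> k)) \<and>
        (\<lambda>k. \<integral>\<^sup>+\<omega>. (\<integral>\<^sup>+s\<in>{0..T}. ennreal ((f s \<omega> - simple_process (n k) (\<tau> k) (\<xi> k) s \<omega>)\<^sup>2) \<partial>lborel) \<partial>M)
          \<longlonglongrightarrow> 0 \<and>
        (\<lambda>k. \<integral>\<^sup>+\<omega>. ennreal ((J \<omega> - simple_ito_integral w (n k) (\<tau> k) (\<xi> k) \<omega>)\<^sup>2) \<partial>M)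
          \<longlonglongrightarrow> 0)"

definition ito_integrable where
  "ito_integrable M F w T f \<longleftrightarrow> (\<exists>J. has_ito_integral M F w T f J)"

definition ito_integral where
  "ito_integral M F w T f = (SOME J. has_ito_integral M F w T f J)"

section \<open>The stochastic system\<close>

text \<open>
  A random field is a function \<open>v t \<omega> x\<close>. The sample paths of an element of
  \<open>L\<^sup>2(\<Omega>; C([0,T]; H\<^sup>m))\<close> lie in \<open>C([0,T]; H\<^sup>m)\<close> for every \<open>\<omega>\<close>. Measurability in \<open>\<omega>\<close> is
  part of \<open>adapted_field\<close>: as \<open>L\<^sup>2\<close> of the torus is separable, weak and strong measurability agree.
\<close>

definition in_L2_C_sobolev ::
  "'a measure \<Rightarrow> nat \<Rightarrow> real \<Rightarrow> (real \<Rightarrow> 'a \<Rightarrow> real \<Rightarrow> real) \<Rightarrow> bool" where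
  "in_L2_C_sobolev M m T v \<longleftrightarrow>
     (\<forall>\<omega>\<in>space M. \<forall>t\<in>{0..T}. v t \<omega> \<in> sobolev_torus m \<and>
        ((\<lambda>s. sobolev_norm m (\<lambda>x. v s \<omega> x - v t \<omega> x)) \<longlongrightarrow> 0) (at t within {0..T})) \<and>
     (\<integral>\<^sup>+\<omega>. (SUP t\<in>{0..T}. ennreal ((sobolev_norm m (v t \<omega>))\<^sup>2)) \<partial>M) < \<infinity>"

definition adapted_field ::
  "(real \<Rightarrow> 'a measure) \<Rightarrow> (real \<Rightarrow> 'a \<Rightarrow> real \<Rightarrow> real) \<Rightarrow> bool" where
  "adapted_field F v \<longleftrightarrow>
     (\<forall>t\<ge>0. \<forall>g\<in>L2_torus. (\<lambda>\<omega>. torus_inner (v t \<omega>) g) \<in> borel_measurable (F t))"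

text \<open>
  \<open>ito_equation M F w v a b\<close> says \<open>dv = a dt + b dw\<close> on \<open>[0,\<infinity>)\<close>, as an identity between functions
  on the torus, i.e. after pairing with an arbitrary smooth function.
\<close>

definition ito_equation ::
  "'a measure \<Rightarrow> (real \<Rightarrow> 'a measure) \<Rightarrow> (real \<Rightarrow> 'a \<Rightarrow> real) \<Rightarrow>
   (real \<Rightarrow> 'a \<Rightarrow> real \<Rightarrow> real) \<Rightarrow> (real \<Rightarrow> 'a \<Rightarrow> real \<Rightarrow> real) \<Rightarrow>
   (real \<Rightarrow> 'a \<Rightarrow> real \<Rightarrow> real) \<Rightarrow> bool" where
  "ito_equation M F w v a b \<longleftrightarrow> (\<forall>\<phi>\<in>smooth_torus. \<forall>t\<ge>0.
     ito_integrable M F w t (\<lambda>s \<omega>. torus_inner (b s \<omega>) \<phi>) \<and>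
     (AE \<omega> in M. torus_inner (v t \<omega>) \<phi> = torus_inner (v 0 \<omega>) \<phi>
        + (LINT s:{0..t}|lborel. torus_inner (a s \<omega>) \<phi>)
        + ito_integral M F w t (\<lambda>s \<omega>. torus_inner (b s \<omega>) \<phi>) \<omega>))"

definition system_solution ::
  "real \<Rightarrow> real \<Rightarrow> 'a measure \<Rightarrow> (real \<Rightarrow> 'a measure) \<Rightarrow> (real \<Rightarrow> 'a \<Rightarrow> real) \<Rightarrow>
   (real \<Rightarrow> 'a \<Rightarrow> real \<Rightarrow> real) \<Rightarrow> (real \<Rightarrow> 'a \<Rightarrow> real \<Rightarrow> real) \<Rightarrow> bool" where
  "system_solution l \<mu> M F w u1 u2 \<longleftrightarrow>
     adapted_field F u1 \<and> adapted_field F u2 \<and>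
     (\<forall>m. \<forall>T>0. in_L2_C_sobolev M m T u1 \<and> in_L2_C_sobolev M m T u2) \<and>
     ito_equation M F w u1
       (\<lambda>t \<omega>. weak_deriv 2 (u1 t \<omega>))
       (\<lambda>t \<omega> x. l * weak_deriv 1 (u1 t \<omega>) x - \<mu> * weak_deriv 1 (u2 t \<omega>) x) \<and>
     ito_equation M F w u2
       (\<lambda>t \<omega>. weak_deriv 2 (u2 t \<omega>))
       (\<lambda>t \<omega> x. \<mu> * weak_deriv 1 (u1 t \<omega>) x + l * weak_deriv 1 (u2 t \<omega>) x) \<and>
     (AE \<omega> in M. AE x in lborel.
        complex_of_real (u1 0 \<omega> x) + \<i> * complex_of_real (u2 0 \<omega> x) =
        (\<Sum>\<^sub>\<infinity>n::int. complex_of_real (exp (- (real_of_int n)\<^sup>2)) *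
                   exp (\<i> * complex_of_real (real_of_int n * x))))"

definition L2_torus_norm_pair :: "(real \<Rightarrow> real) \<Rightarrow> (real \<Rightarrow> real) \<Rightarrow> real" where
  "L2_torus_norm_pair f g = sqrt ((L2_torus_norm f)\<^sup>2 + (L2_torus_norm g)\<^sup>2)"

end

theory Submission
  imports Defs
begin

text \<open>
  Fix \<open>n\<close> and let \<open>X\<close> be the \<open>n\<close>-th (unnormalised) Fourier coefficient of \<open>u1 + \<i> u2\<close>; it satisfies
  \<open>dX = - n\<^sup>2 X dt + n (\<i> l - \<mu>) X dw\<close> and \<open>X\<^sub>0 = 2 \<pi> exp (- n\<^sup>2)\<close>. Neither this equation has to be
  solved nor Ito's formula is needed: testing it against the weight \<open>Z = exp (\<theta> w\<^sub>t)\<close>, under which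
  \<open>dw\<close> acts like \<open>\<theta> dt\<close> in expectation, gives a linear integral equation for \<open>E [Z X\<^sub>s]\<close>, hence
  \<open>E [Z X\<^sub>t] = X\<^sub>0 E [Z] exp ((- n\<^sup>2 + \<theta> n (\<i> l - \<mu>)) t)\<close>. By Hoelder's inequality
  \<open>\<bar>E [Z X\<^sub>t]\<bar>\<close> divided by the \<open>q\<close>-norm of \<open>Z\<close> is a lower bound for the \<open>p\<close>-norm of \<open>X\<^sub>t\<close>. The choice
  \<open>\<theta> = - (p - 1) n \<mu> - \<i> n l\<close>, for which \<open>Z\<close> is proportional to the extremal function
  \<open>cnj X\<^sub>t \<bar>X\<^sub>t\<bar> powr (p - 2)\<close>, turns this bound into \<open>2 \<pi> exp (n\<^sup>2 (\<epsilon> t - 2) / 2)\<close>, which is unbounded in \<open>n\<close>.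
\<close>

section \<open>Gaussian integrals\<close>

text \<open>The weight has moments of every order, whereas for the solution only second moments are
  given. Pairing the two is thus always legitimate, while a finite \<open>p\<close>-th moment is
  available only as an assumption to be refuted. Second moments are also what the Ito integral is
  made of: it is an \<open>L\<^sup>2\<close> limit of simple integrals, so a fixed square integrable
  weight passes through the limit, and everything reduces to Stein's identity for one Gaussian
  increment.

  In the equation for u1 + i u2 the noise is (l + i \<mu>) d/dx, that is, multiplication by n (i l -
  \<mu>) on mode n. Formally the mode is a deterministic factor times exp (n (i l - \<mu>) w): \<mu>
  drives its modulus and l only its phase, and the imaginary part of \<theta> cancels that phase.

  The threshold 2 / \<epsilon> balances two quadratic exponents: the datum costs n^2, the noise
  gains n^2 \<epsilon> t / 2. For each single n the lower bound is finite; divergence comes from the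
  absence of a bound uniform in n.\<close>

lemma normal_density_exp_shift:
  assumes "0 < \<sigma>"
  shows "normal_density 0 \<sigma> x * exp (a * x) = exp (a\<^sup>2 * \<sigma>\<^sup>2 / 2) * normal_density (a * \<sigma>\<^sup>2) \<sigma> x"
proof -
  have "- x\<^sup>2 / (2 * \<sigma>\<^sup>2) + a * x = a\<^sup>2 * \<sigma>\<^sup>2 / 2 + - (x - a * \<sigma>\<^sup>2)\<^sup>2 / (2 * \<sigma>\<^sup>2)"
    using assms by (simp add: field_simps power2_eq_square)
  then have "exp (- x\<^sup>2 / (2 * \<sigma>\<^sup>2)) * exp (a * x) =
      exp (a\<^sup>2 * \<sigma>\<^sup>2 / 2) * exp (- (x - a * \<sigma>\<^sup>2)\<^sup>2 / (2 * \<sigma>\<^sup>2))"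
    by (simp flip: exp_add)
  then show ?thesis by (simp add: normal_density_def)
qed

lemma norm_exp_complex_times_real: "norm (exp (\<theta> * complex_of_real x)) = exp (Re \<theta> * x)"
  by (simp add: norm_exp_eq_Re)

text \<open>Multiplying by the exponential tilts the Gaussian: in modulus the integrand is a
  constant times the density with mean \<open>Re \<theta> * \<sigma>\<^sup>2\<close>, so
  integrability reduces to the total mass and the first moment of a normal law.\<close>

lemma
  assumes "0 < \<sigma>"
  shows integrable_normal_exp: "integrable lborel (\<lambda>x. normal_density 0 \<sigma> x *\<^sub>R exp (\<theta> * complex_of_real x))"
    and integrable_normal_moment_exp:
      "integrable lborel (\<lambda>x. normal_density 0 \<sigma> x *\<^sub>R (of_real x * exp (\<theta> * complex_of_real x)))"
proof -
  let ?m = "Re \<theta> * \<sigma>\<^sup>2" and ?C = "exp ((Re \<theta>)\<^sup>2 * \<sigma>\<^sup>2 / 2)"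
  have "integrable lborel (\<lambda>x. ?C * normal_density ?m \<sigma> x)"
    using assms by simp
  then show "integrable lborel (\<lambda>x. normal_density 0 \<sigma> x *\<^sub>R exp (\<theta> * complex_of_real x))"
    by (rule Bochner_Integration.integrable_bound)
       (auto simp: norm_exp_complex_times_real normal_density_exp_shift[OF assms])
  have "integrable lborel (\<lambda>x. ?C * (normal_density ?m \<sigma> x * x))"
    using integrable_normal_moment_nz_1[OF assms] by simp
  then show "integrable lborel (\<lambda>x. normal_density 0 \<sigma> x *\<^sub>R (of_real x * exp (\<theta> * complex_of_real x)))"
  proof (rule Bochner_Integration.integrable_bound)
    show "AE x in lborel. norm (normal_density 0 \<sigma> x *\<^sub>R (of_real x * exp (\<theta> * complex_of_real x)))
        \<le> norm (?C * (normal_density ?m \<sigma> x * x))"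
    proof (intro always_eventually allI)
      fix x
      have "norm (normal_density 0 \<sigma> x *\<^sub>R (of_real x * exp (\<theta> * complex_of_real x))) =
          (normal_density 0 \<sigma> x * exp (Re \<theta> * x)) * \<bar>x\<bar>"
        by (simp add: norm_mult norm_exp_complex_times_real)
      also have "\<dots> = norm (?C * (normal_density ?m \<sigma> x * x))"
        unfolding normal_density_exp_shift[OF assms] by (simp add: abs_mult)
      finally show "norm (normal_density 0 \<sigma> x *\<^sub>R (of_real x * exp (\<theta> * complex_of_real x)))
        \<le> norm (?C * (normal_density ?m \<sigma> x * x))" by simp
    qed
  qed simp
qed

lemma normal_density_tendsto_0:
  assumes "0 < \<sigma>"
  shows "(normal_density m \<sigma> \<longlongrightarrow> 0) at_top" "(normal_density m \<sigma> \<longlongrightarrow> 0) at_bot"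
proof -
  have 1: "((\<lambda>x. exp (- (x - m)\<^sup>2 / (2 * \<sigma>\<^sup>2))) \<longlongrightarrow> 0) at_top"
    using assms by real_asymp
  have 2: "((\<lambda>x. exp (- (x - m)\<^sup>2 / (2 * \<sigma>\<^sup>2))) \<longlongrightarrow> 0) at_bot"
    using assms by real_asymp
  show "(normal_density m \<sigma> \<longlongrightarrow> 0) at_top" "(normal_density m \<sigma> \<longlongrightarrow> 0) at_bot"
    unfolding normal_density_def
    using tendsto_mult_right_zero[OF 1] tendsto_mult_right_zero[OF 2] by blast+
qed

text \<open>Stein's identity for the test function \<open>exp (\<theta> x)\<close>, by integration by parts.\<close>

lemma integral_normal_moment_exp:
  assumes "0 < \<sigma>"
  shows "(\<integral>x. normal_density 0 \<sigma> x *\<^sub>R (of_real x * exp (\<theta> * complex_of_real x)) \<partial>lborel) =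
    \<theta> * of_real (\<sigma>\<^sup>2) * (\<integral>x. normal_density 0 \<sigma> x *\<^sub>R exp (\<theta> * complex_of_real x) \<partial>lborel)"
proof -
  let ?G = "\<lambda>x. normal_density 0 \<sigma> x *\<^sub>R exp (\<theta> * complex_of_real x)"
  let ?H = "\<lambda>x. normal_density 0 \<sigma> x *\<^sub>R (of_real x * exp (\<theta> * complex_of_real x))"
  \<comment> \<open>\<open>?g\<close> is the derivative of \<open>?G\<close>. Its integral over the
    line vanishes because the boundary terms do, and this is the claim divided by the
    variance.\<close>
  let ?g = "\<lambda>x. \<theta> * ?G x - of_real (1 / \<sigma>\<^sup>2) * ?H x"
  have int: "integrable lborel ?g"
    by (intro Bochner_Integration.integrable_diff integrable_mult_right
          integrable_normal_exp integrable_normal_moment_exp assms)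
  have deriv: "(?G has_vector_derivative ?g x) (at x)" for x
  proof -
    have "((\<lambda>z. exp (\<theta> * z)) has_field_derivative exp (\<theta> * of_real x) * \<theta>) (at (complex_of_real x))"
      by (auto intro!: derivative_eq_intros)
    then have 1: "((\<lambda>x. exp (\<theta> * complex_of_real x)) has_vector_derivative exp (\<theta> * of_real x) * \<theta>) (at x)"
      by (rule has_vector_derivative_real_field)
    have 2: "(normal_density 0 \<sigma> has_field_derivative - (x / \<sigma>\<^sup>2) * normal_density 0 \<sigma> x) (at x)"
      using assms unfolding normal_density_def
      by (auto intro!: derivative_eq_intros simp: field_simps power2_eq_square)
    show ?thesis
      by (rule has_vector_derivative_eq_rhs[OF has_vector_derivative_scaleR[OF 2 1]])
         (simp add: scaleR_conv_of_real field_simps)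
  qed
  have cont: "isCont ?g x" for x
    unfolding normal_density_def using assms by (intro continuous_intros) auto
  have normG: "norm (?G x) = exp ((Re \<theta>)\<^sup>2 * \<sigma>\<^sup>2 / 2) * normal_density (Re \<theta> * \<sigma>\<^sup>2) \<sigma> x" for x
    using normal_density_exp_shift[OF assms, of x "Re \<theta>"] by (simp add: norm_exp_complex_times_real)
  have top: "(?G \<longlongrightarrow> 0) at_top"
    by (rule tendsto_norm_zero_cancel, unfold normG)
       (rule tendsto_mult_right_zero[OF normal_density_tendsto_0(1)[OF assms]])
  have bot: "(?G \<longlongrightarrow> 0) at_bot"
    by (rule tendsto_norm_zero_cancel, unfold normG)
       (rule tendsto_mult_right_zero[OF normal_density_tendsto_0(2)[OF assms]])
  have "(LBINT x=-\<infinity>..\<infinity>. ?g x) = 0 - 0"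
  proof (rule interval_integral_FTC_integrable[where F = ?G])
    show "set_integrable lborel (einterval (-\<infinity>) \<infinity>) ?g"
      using int by (simp add: set_integrable_def)
    show "((?G \<circ> real_of_ereal) \<longlongrightarrow> 0) (at_right (-\<infinity>))"
      using bot by (simp add: ereal_tendsto_simps1)
    show "((?G \<circ> real_of_ereal) \<longlongrightarrow> 0) (at_left \<infinity>)"
      using top by (simp add: ereal_tendsto_simps1)
  qed (use deriv cont in auto)
  then have "0 = (\<integral>x. ?g x \<partial>lborel)"
    by (simp add: interval_lebesgue_integral_def set_lebesgue_integral_def)
  also have "\<dots> = \<theta> * (\<integral>x. ?G x \<partial>lborel) - of_real (1 / \<sigma>\<^sup>2) * (\<integral>x. ?H x \<partial>lborel)"
    unfolding integral_mult_right_zero[symmetric]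
    by (intro Bochner_Integration.integral_diff integrable_mult_right
          integrable_normal_exp integrable_normal_moment_exp assms)
  finally show ?thesis using assms by (simp add: field_simps)
qed

text \<open>The real part of \<open>\<theta>\<close> tilts the Gaussian and enlarges the integral;
  the imaginary part is the argument of a characteristic function and shrinks it. Hence the
  difference of squares. The shifted mean only adds a factor of modulus 1, which the norm
  discards.\<close>

lemma norm_integral_normal_exp:
  assumes "0 < \<sigma>"
  shows "norm (\<integral>x. normal_density 0 \<sigma> x *\<^sub>R exp (\<theta> * complex_of_real x) \<partial>lborel) =
    exp (((Re \<theta>)\<^sup>2 - (Im \<theta>)\<^sup>2) * \<sigma>\<^sup>2 / 2)"
proof -
  let ?a = "Re \<theta>" and ?b = "Im \<theta>"
  let ?m = "?a * \<sigma>\<^sup>2" and ?C = "exp (?a\<^sup>2 * \<sigma>\<^sup>2 / 2)"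
  have eq: "normal_density 0 \<sigma> x *\<^sub>R exp (\<theta> * complex_of_real x) =
      of_real ?C * (normal_density ?m \<sigma> x *\<^sub>R iexp (?b * x))" for x
  proof -
    have "exp (\<theta> * complex_of_real x) = of_real (exp (?a * x)) * iexp (?b * x)"
      by (simp add: exp_of_real[symmetric] exp_add[symmetric] complex_eq_iff
          flip: exp_of_real exp_add) (simp add: complex_eq distrib_right Re_exp Im_exp)
    then have "normal_density 0 \<sigma> x *\<^sub>R exp (\<theta> * complex_of_real x) =
        of_real (normal_density 0 \<sigma> x * exp (?a * x)) * iexp (?b * x)"
      by (simp add: scaleR_conv_of_real)
    also have "\<dots> = of_real ?C * (normal_density ?m \<sigma> x *\<^sub>R iexp (?b * x))"
      unfolding normal_density_exp_shift[OF assms] by (simp add: scaleR_conv_of_real)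
    finally show ?thesis .
  qed
  \<comment> \<open>Substituting \<open>x = ?m + \<sigma> * y\<close> leads to the standard normal
    law, whose characteristic function is known.\<close>
  have "(\<integral>x. normal_density ?m \<sigma> x *\<^sub>R iexp (?b * x) \<partial>lborel) =
      \<bar>\<sigma>\<bar> *\<^sub>R (\<integral>y. normal_density ?m \<sigma> (?m + \<sigma> * y) *\<^sub>R iexp (?b * (?m + \<sigma> * y)) \<partial>lborel)"
    using assms by (intro lborel_integral_real_affine) auto
  also have "\<dots> = (\<integral>y. iexp (?b * ?m) * (std_normal_density y *\<^sub>R iexp (?b * \<sigma> * y)) \<partial>lborel)"
  proof -
    have "\<bar>\<sigma>\<bar> *\<^sub>R (normal_density ?m \<sigma> (?m + \<sigma> * y) *\<^sub>R iexp (?b * (?m + \<sigma> * y))) =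
        iexp (?b * ?m) * (std_normal_density y *\<^sub>R iexp (?b * \<sigma> * y))" for y
    proof -
      have "\<bar>\<sigma>\<bar> * normal_density ?m \<sigma> (?m + \<sigma> * y) = std_normal_density y"
        using assms by (simp add: normal_density_def power_mult_distrib real_sqrt_mult)
      moreover have "iexp (?b * (?m + \<sigma> * y)) = iexp (?b * ?m) * iexp (?b * \<sigma> * y)"
        by (simp add: algebra_simps flip: exp_add)
      ultimately show ?thesis
        by (metis (no_types, lifting) mult_scaleR_right scaleR_scaleR)
    qed
    then show ?thesis
      by (metis (no_types, lifting) Bochner_Integration.integral_cong integral_scaleR_right)
  qed
  also have "\<dots> = iexp (?b * ?m) * (\<integral>y. std_normal_density y *\<^sub>R iexp (?b * \<sigma> * y) \<partial>lborel)"
    by (rule integral_mult_right_zero)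
  also have "(\<integral>y. std_normal_density y *\<^sub>R iexp (?b * \<sigma> * y) \<partial>lborel) =
      char std_normal_distribution (?b * \<sigma>)"
    unfolding char_def by (subst integral_density) auto
  finally have "norm (\<integral>x. normal_density ?m \<sigma> x *\<^sub>R iexp (?b * x) \<partial>lborel) = exp (- (?b * \<sigma>)\<^sup>2 / 2)"
    by (simp add: char_std_normal_distribution norm_mult)
  then show ?thesis
    unfolding eq integral_mult_right_zero by (simp add: norm_mult power_mult_distrib left_diff_distrib diff_divide_distrib flip: exp_add)
qed

section \<open>Exponential weights of the Wiener process\<close>

context filtered_prob_space
begin

lemma measurable_F_mono: "s \<le> t \<Longrightarrow> f \<in> measurable (F s) N \<Longrightarrow> f \<in> measurable (F t) N"
  using sets_F_mono[of s t] space_F[of s] space_F[of t] by (auto simp: measurable_def)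

lemma measurable_F_M: "f \<in> measurable (F s) N \<Longrightarrow> f \<in> measurable M N"
  by (rule measurable_from_subalg[OF subalgebra_F])

end

context wiener_process
begin

lemma wiener_measurable_mono: "0 \<le> s \<Longrightarrow> s \<le> t \<Longrightarrow> w s \<in> borel_measurable (F t)"
  using measurable_F_mono wiener_adapted by blast

lemma wiener_measurable: "0 \<le> s \<Longrightarrow> w s \<in> borel_measurable M"
  using measurable_F_M wiener_adapted by blast

text \<open>Independence is postulated for families of events. The preimages under \<open>Y\<close>
  and under \<open>g\<close> of the increment are subfamilies and stable under intersection, so
  independence extends to the \<sigma>-algebras they generate, as required for random
  variables.\<close>

lemma indep_var_increment:
  fixes Y :: "'a \<Rightarrow> 'b::topological_space" and g :: "real \<Rightarrow> 'b"
  assumes st: "0 \<le> s" "s < t" and Y: "Y \<in> borel_measurable (F s)" and g: "g \<in> borel_measurable borel"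
  shows "indep_var borel Y borel (\<lambda>\<omega>. g (w t \<omega> - w s \<omega>))"
proof -
  let ?D = "\<lambda>\<omega>. w t \<omega> - w s \<omega>"
  let ?\<D> = "{(\<lambda>\<omega>. g (?D \<omega>)) -` A \<inter> space M | A. A \<in> sets borel}"
  let ?\<Y> = "{Y -` A \<inter> space M | A. A \<in> sets borel}"
  have "?\<Y> \<subseteq> sets (F s)"
    using measurable_sets[OF Y] by (auto simp: space_F)
  moreover have "?\<D> \<subseteq> {?D -` A \<inter> space M | A. A \<in> sets borel}"
  proof safe
    fix A :: "'b set" assume "A \<in> sets borel"
    then show "\<exists>A'. (\<lambda>\<omega>. g (?D \<omega>)) -` A \<inter> space M = ?D -` A' \<inter> space M \<and> A' \<in> sets borel"
      using measurable_sets[OF g, of A] by (intro exI[of _ "g -` A"]) auto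
  qed
  ultimately have "indep_set ?\<Y> ?\<D>"
    using wiener_indep[OF st] unfolding indep_sets2_eq by (meson subsetD subset_trans)
  moreover have "Int_stable {X -` A \<inter> space M | A. A \<in> sets borel}" for X :: "'a \<Rightarrow> 'b"
    unfolding Int_stable_def
  proof safe
    fix A A' :: "'b set" assume "A \<in> sets borel" "A' \<in> sets borel"
    then show "\<exists>B. (X -` A \<inter> space M) \<inter> (X -` A' \<inter> space M) = X -` B \<inter> space M \<and> B \<in> sets borel"
      by (intro exI[of _ "A \<inter> A'"]) auto
  qed
  ultimately have "indep_set (sigma_sets (space M) ?\<Y>) (sigma_sets (space M) ?\<D>)"
    by (intro indep_set_sigma_sets)
  moreover have "Y \<in> borel_measurable M" "(\<lambda>\<omega>. g (?D \<omega>)) \<in> borel_measurable M"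
    using measurable_F_M[OF Y] st
    by (auto intro!: measurable_compose[OF _ g] borel_measurable_diff wiener_measurable)
  ultimately show ?thesis
    unfolding indep_var_eq by auto
qed

lemma
  fixes g :: "real \<Rightarrow> 'c::{banach, second_countable_topology}"
  assumes st: "0 \<le> s" "s < t" and g: "g \<in> borel_measurable borel"
  shows integrable_increment: "integrable M (\<lambda>\<omega>. g (w t \<omega> - w s \<omega>)) \<longleftrightarrow>
      integrable lborel (\<lambda>x. normal_density 0 (sqrt (t - s)) x *\<^sub>R g x)"
    and integral_increment: "(\<integral>\<omega>. g (w t \<omega> - w s \<omega>) \<partial>M) =
      (\<integral>x. normal_density 0 (sqrt (t - s)) x *\<^sub>R g x \<partial>lborel)"
proof -
  let ?D = "\<lambda>\<omega>. w t \<omega> - w s \<omega>"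
  have D: "?D \<in> measurable M lborel"
    using st by (auto intro!: borel_measurable_diff wiener_measurable)
  have eq: "distr M lborel ?D = density lborel (\<lambda>x. ennreal (normal_density 0 (sqrt (t - s)) x))"
    by (rule distributed_distr_eq_density[OF wiener_gaussian[OF st]])
  have g': "g \<in> borel_measurable lborel" using g by simp
  show "integrable M (\<lambda>\<omega>. g (?D \<omega>)) \<longleftrightarrow> integrable lborel (\<lambda>x. normal_density 0 (sqrt (t - s)) x *\<^sub>R g x)"
    unfolding integrable_distr_eq[OF D g', symmetric] eq by (rule integrable_density) (use g in auto)
  show "(\<integral>\<omega>. g (?D \<omega>) \<partial>M) = (\<integral>x. normal_density 0 (sqrt (t - s)) x *\<^sub>R g x \<partial>lborel)"
    unfolding integral_distr[OF D g', symmetric] eq by (rule integral_density) (use g in auto)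
qed

text \<open>The weight \<open>exp (\<theta> w\<^sub>T)\<close> enters as the increment from time 0;
  the two agree almost surely because \<open>w 0\<close> vanishes almost surely. With increments the
  weight splits exactly, for every \<open>\<omega>\<close>, into factors over consecutive
  intervals.\<close>

definition exp_increment :: "complex \<Rightarrow> real \<Rightarrow> real \<Rightarrow> 'a \<Rightarrow> complex" where
  "exp_increment \<theta> s t \<omega> = exp (\<theta> * complex_of_real (w t \<omega> - w s \<omega>))"

lemma exp_increment_refl: "exp_increment \<theta> s s = (\<lambda>\<omega>. 1)"
  by (simp add: exp_increment_def fun_eq_iff)

lemma exp_increment_mult: "exp_increment \<theta> r s \<omega> * exp_increment \<theta> s t \<omega> = exp_increment \<theta> r t \<omega>"
  by (simp add: exp_increment_def algebra_simps flip: exp_add)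

lemma norm_exp_increment: "norm (exp_increment \<theta> s t \<omega>) = exp (Re \<theta> * (w t \<omega> - w s \<omega>))"
  unfolding exp_increment_def by (rule norm_exp_complex_times_real)

lemma exp_increment_measurable_F:
  "0 \<le> s \<Longrightarrow> s \<le> t \<Longrightarrow> exp_increment \<theta> s t \<in> borel_measurable (F t)"
  unfolding exp_increment_def using wiener_measurable_mono[of s t] wiener_measurable_mono[of t t]
  by (auto intro!: borel_measurable_exp borel_measurable_times borel_measurable_of_real borel_measurable_diff)

lemma exp_increment_measurable: "0 \<le> s \<Longrightarrow> s \<le> t \<Longrightarrow> exp_increment \<theta> s t \<in> borel_measurable M"
  using exp_increment_measurable_F measurable_F_M by blast

lemma integrable_exp_increment:
  assumes "0 \<le> s" "s \<le> t"
  shows "integrable M (exp_increment \<theta> s t)"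
proof (cases "s = t")
  case False
  then show ?thesis
    using assms integrable_increment[of s t "\<lambda>x. exp (\<theta> * complex_of_real x)"]
      integrable_normal_exp[of "sqrt (t - s)" \<theta>]
    unfolding exp_increment_def by simp
qed (simp add: exp_increment_refl)

lemma norm_expectation_exp_increment:
  assumes "0 \<le> s" "s \<le> t"
  shows "norm (\<integral>\<omega>. exp_increment \<theta> s t \<omega> \<partial>M) = exp (((Re \<theta>)\<^sup>2 - (Im \<theta>)\<^sup>2) * (t - s) / 2)"
proof (cases "s = t")
  case False
  then show ?thesis
    using assms integral_increment[of s t "\<lambda>x. exp (\<theta> * complex_of_real x)"]
      norm_integral_normal_exp[of "sqrt (t - s)" \<theta>]
    unfolding exp_increment_def by simp
qed (simp add: exp_increment_refl prob_space)

text \<open>The \<open>q\<close>-th power of the modulus is again an exponential weight, with the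
  real parameter \<open>q * Re \<theta>\<close>. Being positive, its expectation is its own norm, so
  the formula for the norm of the expectation applies.\<close>

lemma
  assumes "0 \<le> s" "s \<le> t"
  shows integrable_norm_exp_increment_powr: "integrable M (\<lambda>\<omega>. norm (exp_increment \<theta> s t \<omega>) powr q)"
    and expectation_norm_exp_increment_powr:
      "(\<integral>\<omega>. norm (exp_increment \<theta> s t \<omega>) powr q \<partial>M) = exp ((q * Re \<theta>)\<^sup>2 * (t - s) / 2)"
proof -
  let ?\<eta> = "complex_of_real (q * Re \<theta>)"
  have eq: "exp_increment ?\<eta> s t \<omega> = of_real (norm (exp_increment \<theta> s t \<omega>) powr q)" for \<omega>
    unfolding norm_exp_increment by (simp add: exp_increment_def powr_def algebra_simps flip: exp_of_real)
  show "integrable M (\<lambda>\<omega>. norm (exp_increment \<theta> s t \<omega>) powr q)"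
    using integrable_norm[OF integrable_exp_increment[OF assms, of ?\<eta>]] unfolding eq by simp
  have "exp ((q * Re \<theta>)\<^sup>2 * (t - s) / 2) = norm (\<integral>\<omega>. exp_increment ?\<eta> s t \<omega> \<partial>M)"
    by (simp add: norm_expectation_exp_increment[OF assms])
  also have "\<dots> = \<bar>\<integral>\<omega>. norm (exp_increment \<theta> s t \<omega>) powr q \<partial>M\<bar>"
    unfolding eq integral_complex_of_real by simp
  finally show "(\<integral>\<omega>. norm (exp_increment \<theta> s t \<omega>) powr q \<partial>M) = exp ((q * Re \<theta>)\<^sup>2 * (t - s) / 2)"
    by simp
qed

text \<open>The increment is independent of the past. The case \<open>s = t\<close>, where the
  weight is 1, stands apart because the Gaussian law is postulated for \<open>s < t\<close>
  only.\<close>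

lemma
  fixes V :: "'a \<Rightarrow> complex"
  assumes st: "0 \<le> s" "s \<le> t" and V: "V \<in> borel_measurable (F s)" "integrable M V"
  shows integrable_mult_exp_increment: "integrable M (\<lambda>\<omega>. V \<omega> * exp_increment \<theta> s t \<omega>)"
    and expectation_mult_exp_increment:
      "(\<integral>\<omega>. V \<omega> * exp_increment \<theta> s t \<omega> \<partial>M) = (\<integral>\<omega>. V \<omega> \<partial>M) * (\<integral>\<omega>. exp_increment \<theta> s t \<omega> \<partial>M)"
proof -
  have "integrable M (\<lambda>\<omega>. V \<omega> * exp_increment \<theta> s t \<omega>) \<and>
      (\<integral>\<omega>. V \<omega> * exp_increment \<theta> s t \<omega> \<partial>M) = (\<integral>\<omega>. V \<omega> \<partial>M) * (\<integral>\<omega>. exp_increment \<theta> s t \<omega> \<partial>M)"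
  proof (cases "s = t")
    case True
    then show ?thesis using V by (simp add: exp_increment_refl prob_space)
  next
    case False
    with st have "indep_var borel V borel (exp_increment \<theta> s t)"
      unfolding exp_increment_def
      by (intro indep_var_increment[where g = "\<lambda>x. exp (\<theta> * complex_of_real x)"] V) auto
    then show ?thesis
      using indep_var_integrable indep_var_lebesgue_integral V integrable_exp_increment[OF st] by blast
  qed
  then show "integrable M (\<lambda>\<omega>. V \<omega> * exp_increment \<theta> s t \<omega>)"
    "(\<integral>\<omega>. V \<omega> * exp_increment \<theta> s t \<omega> \<partial>M) = (\<integral>\<omega>. V \<omega> \<partial>M) * (\<integral>\<omega>. exp_increment \<theta> s t \<omega> \<partial>M)"
    by blast+
qed

text \<open>
  Under the (complex) weight \<open>exp (\<theta> w\<^sub>T)\<close> the Wiener process acquires the drift \<open>\<theta>\<close>: this is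
  all of Girsanov's theorem that is needed here.
\<close>

lemma
  fixes Y :: "'a \<Rightarrow> complex"
  assumes ab: "0 \<le> a" "a \<le> b" "b \<le> T"
    and Y: "Y \<in> borel_measurable (F a)" and bdd: "\<And>\<omega>. \<omega> \<in> space M \<Longrightarrow> norm (Y \<omega>) \<le> C"
  shows integrable_exp_increment_mult_increment:
      "integrable M (\<lambda>\<omega>. exp_increment \<theta> 0 T \<omega> * (Y \<omega> * of_real (w b \<omega> - w a \<omega>)))"
    and expectation_exp_increment_mult_increment:
      "(\<integral>\<omega>. exp_increment \<theta> 0 T \<omega> * (Y \<omega> * of_real (w b \<omega> - w a \<omega>)) \<partial>M) =
        \<theta> * of_real (b - a) * (\<integral>\<omega>. exp_increment \<theta> 0 T \<omega> * Y \<omega> \<partial>M)"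
proof -
  let ?Z = "exp_increment \<theta> 0 T" and ?E = "exp_increment \<theta>"
  \<comment> \<open>The weight splits at \<open>a\<close> and \<open>b\<close>. \<open>G\<close> is
    known at time \<open>a\<close>, \<open>H\<close> depends only on the increment over the interval
    from \<open>a\<close> to \<open>b\<close> and is where Stein's identity acts, and the factor
    after \<open>b\<close> is independent of both. The expectations of the outer factors occur
    equally on both sides.\<close>
  define G where "G \<omega> = ?E 0 a \<omega> * Y \<omega>" for \<omega>
  define H where "H \<omega> = of_real (w b \<omega> - w a \<omega>) * ?E a b \<omega>" for \<omega>
  have "integrable M (\<lambda>\<omega>. ?Z \<omega> * (Y \<omega> * of_real (w b \<omega> - w a \<omega>))) \<and>
      (\<integral>\<omega>. ?Z \<omega> * (Y \<omega> * of_real (w b \<omega> - w a \<omega>)) \<partial>M) =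
        \<theta> * of_real (b - a) * (\<integral>\<omega>. ?Z \<omega> * Y \<omega> \<partial>M)"
  \<comment> \<open>Partitions may contain degenerate intervals; for these both sides are 0.\<close>
  proof (cases "a = b")
    case False
    with ab have "a < b" by simp
    then have "0 < sqrt (b - a)" by simp
    note stein = integrable_normal_moment_exp[OF this, of \<theta>] integral_normal_moment_exp[OF this, of \<theta>]
    have G_F: "G \<in> borel_measurable (F a)"
      unfolding G_def using ab Y by (intro borel_measurable_times exp_increment_measurable_F) auto
    have G_int: "integrable M G"
    proof (rule Bochner_Integration.integrable_bound)
      show "integrable M (\<lambda>\<omega>. C *\<^sub>R norm (?E 0 a \<omega>))"
        using ab integrable_exp_increment[of 0 a \<theta>] by auto
      show "AE \<omega> in M. norm (G \<omega>) \<le> norm (C *\<^sub>R norm (?E 0 a \<omega>))"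
      proof (rule AE_I2)
        fix \<omega> assume "\<omega> \<in> space M"
        from bdd[OF this] have "norm (Y \<omega>) \<le> \<bar>C\<bar>" by linarith
        then show "norm (G \<omega>) \<le> norm (C *\<^sub>R norm (?E 0 a \<omega>))"
          by (simp add: G_def norm_mult abs_mult mult.commute mult_right_mono)
      qed
      show "G \<in> borel_measurable M" using G_F measurable_F_M by blast
    qed
    have H_int: "integrable M H" and H_exp: "(\<integral>\<omega>. H \<omega> \<partial>M) = \<theta> * of_real (b - a) * (\<integral>\<omega>. ?E a b \<omega> \<partial>M)"
      using integrable_increment[of a b "\<lambda>x. of_real x * exp (\<theta> * of_real x)"]
        integral_increment[of a b "\<lambda>x. of_real x * exp (\<theta> * of_real x)"]
        integral_increment[of a b "\<lambda>x. exp (\<theta> * of_real x)"] stein ab \<open>a < b\<close>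
      unfolding H_def exp_increment_def by simp_all
    have "indep_var borel G borel H"
      unfolding H_def exp_increment_def using ab \<open>a < b\<close>
      by (intro indep_var_increment[where g = "\<lambda>x. of_real x * exp (\<theta> * of_real x)"] G_F) auto
    note GH = indep_var_integrable[OF this G_int H_int] indep_var_lebesgue_integral[OF this G_int H_int]
    have GH_F: "(\<lambda>\<omega>. G \<omega> * H \<omega>) \<in> borel_measurable (F b)"
      unfolding H_def using measurable_F_mono[OF \<open>a \<le> b\<close> G_F] ab
        wiener_measurable_mono[of a b] wiener_measurable_mono[of b b]
      by (intro borel_measurable_times exp_increment_measurable_F borel_measurable_of_real borel_measurable_diff) auto
    have eq1: "?Z \<omega> * (Y \<omega> * of_real (w b \<omega> - w a \<omega>)) = (G \<omega> * H \<omega>) * ?E b T \<omega>" for \<omega>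
      unfolding G_def H_def
      by (subst exp_increment_mult[of \<theta> 0 a, symmetric], subst exp_increment_mult[of \<theta> a b, symmetric]) simp
    have eq2: "?Z \<omega> * Y \<omega> = (G \<omega> * ?E a b \<omega>) * ?E b T \<omega>" for \<omega>
      unfolding G_def
      by (subst exp_increment_mult[of \<theta> 0 a, symmetric], subst exp_increment_mult[of \<theta> a b, symmetric]) simp
    have "0 \<le> b" using ab by simp
    have GE_F: "(\<lambda>\<omega>. G \<omega> * ?E a b \<omega>) \<in> borel_measurable (F b)"
      using measurable_F_mono[OF \<open>a \<le> b\<close> G_F] ab
      by (intro borel_measurable_times exp_increment_measurable_F) auto
    note GE = integrable_mult_exp_increment[OF ab(1,2) G_F G_int, of \<theta>]
      expectation_mult_exp_increment[OF ab(1,2) G_F G_int, of \<theta>]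
    note GHE = integrable_mult_exp_increment[OF \<open>0 \<le> b\<close> ab(3) GH_F GH(1), of \<theta>]
      expectation_mult_exp_increment[OF \<open>0 \<le> b\<close> ab(3) GH_F GH(1), of \<theta>]
    note GEE = expectation_mult_exp_increment[OF \<open>0 \<le> b\<close> ab(3) GE_F GE(1), of \<theta>]
    show ?thesis
      unfolding eq1 eq2 GHE(2) GEE GH(2) GE(2) H_exp using GHE(1) by (simp add: mult_ac)
  qed simp
  then show "integrable M (\<lambda>\<omega>. ?Z \<omega> * (Y \<omega> * of_real (w b \<omega> - w a \<omega>)))"
    "(\<integral>\<omega>. ?Z \<omega> * (Y \<omega> * of_real (w b \<omega> - w a \<omega>)) \<partial>M) =
        \<theta> * of_real (b - a) * (\<integral>\<omega>. ?Z \<omega> * Y \<omega> \<partial>M)"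
    by blast+
qed

end

section \<open>Pairing an Ito integral with an exponential weight\<close>

text \<open>The first bound is stated without integrability of the product, so that it can be
  applied to every term of a sequence, including terms whose second moment may be infinite.\<close>

lemma
  fixes Z :: "'b \<Rightarrow> complex" and f :: "'b \<Rightarrow> real"
  assumes [measurable]: "Z \<in> borel_measurable N" "f \<in> borel_measurable N"
  shows norm_integral_mult_Cauchy_Schwarz:
      "ennreal ((norm (\<integral>x. Z x * of_real (f x) \<partial>N))\<^sup>2) \<le>
        (\<integral>\<^sup>+x. ennreal ((norm (Z x))\<^sup>2) \<partial>N) * (\<integral>\<^sup>+x. ennreal ((f x)\<^sup>2) \<partial>N)"
    and integrable_L2_mult:
      "(\<integral>\<^sup>+x. ennreal ((norm (Z x))\<^sup>2) \<partial>N) < \<infinity> \<Longrightarrow> (\<integral>\<^sup>+x. ennreal ((f x)\<^sup>2) \<partial>N) < \<infinity> \<Longrightarrow>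
        integrable N (\<lambda>x. Z x * of_real (f x))"
proof -
  let ?L = "\<integral>\<^sup>+x. ennreal (norm (Z x * of_real (f x))) \<partial>N"
  let ?R = "(\<integral>\<^sup>+x. ennreal ((norm (Z x))\<^sup>2) \<partial>N) * (\<integral>\<^sup>+x. ennreal ((f x)\<^sup>2) \<partial>N)"
  have CS: "?L\<^sup>2 \<le> ?R"
    using Cauchy_Schwarz_nn_integral[of "\<lambda>x. ennreal (norm (Z x))" N "\<lambda>x. ennreal \<bar>f x\<bar>"]
    by (simp add: norm_mult ennreal_mult ennreal_power)
  show "ennreal ((norm (\<integral>x. Z x * of_real (f x) \<partial>N))\<^sup>2) \<le> ?R"
  proof (cases "integrable N (\<lambda>x. Z x * of_real (f x))")
    case True
    have "(ennreal (norm (\<integral>x. Z x * of_real (f x) \<partial>N)))\<^sup>2 \<le> ?L\<^sup>2"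
      by (intro power_mono integral_norm_bound_ennreal True) auto
    with CS show ?thesis by (simp add: ennreal_power)
  \<comment> \<open>A product that is not integrable has Bochner integral 0 by convention.\<close>
  qed (simp add: not_integrable_integral_eq)
  assume "(\<integral>\<^sup>+x. ennreal ((norm (Z x))\<^sup>2) \<partial>N) < \<infinity>" "(\<integral>\<^sup>+x. ennreal ((f x)\<^sup>2) \<partial>N) < \<infinity>"
  then have "?L\<^sup>2 < \<infinity>" using CS by (auto simp: ennreal_mult_less_top intro: order_le_less_trans)
  then have "?L < \<infinity>" by (simp add: power_less_top_ennreal)
  then show "integrable N (\<lambda>x. Z x * of_real (f x))"
    by (intro integrableI_bounded) auto
qed

text \<open>Pairing with a fixed square integrable \<open>Z\<close> is continuous in
  \<open>L\<^sup>2\<close>. It is used twice for one Ito integral: on the probability space for the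
  integrals, and on the product with a time interval for the integrands.\<close>

lemma integral_L2_mult_tendsto_0:
  fixes Z :: "'b \<Rightarrow> complex" and f :: "nat \<Rightarrow> 'b \<Rightarrow> real"
  assumes Z: "Z \<in> borel_measurable N" and f: "\<And>k. f k \<in> borel_measurable N"
    and ZL2: "(\<integral>\<^sup>+x. ennreal ((norm (Z x))\<^sup>2) \<partial>N) < \<infinity>"
    and lim: "(\<lambda>k. \<integral>\<^sup>+x. ennreal ((f k x)\<^sup>2) \<partial>N) \<longlonglongrightarrow> 0"
  shows "(\<lambda>k. \<integral>x. Z x * of_real (f k x) \<partial>N) \<longlonglongrightarrow> 0"
proof -
  let ?A = "\<integral>\<^sup>+x. ennreal ((norm (Z x))\<^sup>2) \<partial>N"
  have "(\<lambda>k. ?A * (\<integral>\<^sup>+x. ennreal ((f k x)\<^sup>2) \<partial>N)) \<longlonglongrightarrow> ?A * 0"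
    using ZL2 by (intro ennreal_tendsto_cmult lim) auto
  then have lim': "(\<lambda>k. ?A * (\<integral>\<^sup>+x. ennreal ((f k x)\<^sup>2) \<partial>N)) \<longlonglongrightarrow> 0"
    by simp
  have "(\<lambda>k. ennreal ((norm (\<integral>x. Z x * of_real (f k x) \<partial>N))\<^sup>2)) \<longlonglongrightarrow> 0"
    by (rule tendsto_sandwich[OF _ _ tendsto_const lim'])
       (intro always_eventually allI zero_le norm_integral_mult_Cauchy_Schwarz Z f)+
  then have "(\<lambda>k. ennreal ((norm (\<integral>x. Z x * of_real (f k x) \<partial>N))\<^sup>2)) \<longlonglongrightarrow> ennreal 0"
    by simp
  then have "(\<lambda>k. (norm (\<integral>x. Z x * of_real (f k x) \<partial>N))\<^sup>2) \<longlonglongrightarrow> 0"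
    by (subst (asm) tendsto_ennreal_iff) auto
  then have "(\<lambda>k. sqrt ((norm (\<integral>x. Z x * of_real (f k x) \<partial>N))\<^sup>2)) \<longlonglongrightarrow> sqrt 0"
    by (rule tendsto_real_sqrt)
  then show ?thesis by (simp add: tendsto_norm_zero_iff)
qed

lemma simple_integrand_times:
  assumes "simple_integrand F t n \<tau> \<xi>" "i < n"
  shows "0 \<le> \<tau> i" "\<tau> i \<le> \<tau> (Suc i)" "\<tau> (Suc i) \<le> t"
proof -
  have step: "\<tau> j \<le> \<tau> (Suc j)" if "j < n" for j
    using assms(1) that by (simp add: simple_integrand_def)
  have mono: "\<tau> j \<le> \<tau> k" if "j \<le> k" "k \<le> n" for j k
    using that(1,2)
  proof (induction k rule: dec_induct)
    case (step k)
    then show ?case using \<open>\<And>j. j < n \<Longrightarrow> \<tau> j \<le> \<tau> (Suc j)\<close>[of k] by simp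
  qed simp
  show "0 \<le> \<tau> i" "\<tau> i \<le> \<tau> (Suc i)" "\<tau> (Suc i) \<le> t"
    using mono[of 0 i] mono[of i "Suc i"] mono[of "Suc i" n] assms by (auto simp: simple_integrand_def)
qed

lemma set_integral_eq_restrict_space:
  fixes g :: "real \<Rightarrow> 'b::{banach, second_countable_topology}"
  shows "(LINT s:{a..b}|lborel. g s) = (\<integral>s. g s \<partial>restrict_space lborel {a..b})"
  by (simp add: set_lebesgue_integral_def integral_restrict_space)

context filtered_prob_space
begin

text \<open>Only the \<sigma>-algebra in the second factor grows, from \<open>F t\<close> to that of
  \<open>M\<close>. This supplies the joint measurability that Fubini's theorem asks for.\<close>

lemma progressive_measurable:
  assumes "progressive F t f" "0 \<le> t"
  shows "(\<lambda>(s, \<omega>). f s \<omega>) \<in> borel_measurable (restrict_space lborel {0..t} \<Otimes>\<^sub>M M)"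
proof -
  let ?R = "restrict_space lborel {0..t}"
  have "fst \<in> measurable (?R \<Otimes>\<^sub>M M) (restrict_space borel {0..t})"
    using measurable_fst[of ?R M] measurable_cong_sets[OF refl sets_restrict_space_cong[OF sets_lborel]]
    by blast
  moreover have "snd \<in> measurable (?R \<Otimes>\<^sub>M M) (F t)"
    using measurable_snd[of ?R M] subalgebra_F[of t] by (auto simp: measurable_def subalgebra_def)
  ultimately have "(\<lambda>p. (fst p, snd p)) \<in> measurable (?R \<Otimes>\<^sub>M M) (restrict_space borel {0..t} \<Otimes>\<^sub>M F t)"
    by (rule measurable_Pair)
  moreover have "(\<lambda>(s, \<omega>). f s \<omega>) \<in> borel_measurable (restrict_space borel {0..t} \<Otimes>\<^sub>M F t)"
    using assms by (simp add: progressive_def)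
  ultimately show ?thesis
    using measurable_compose by fastforce
qed

end


context wiener_process
begin

lemma exp_increment_L2: "0 \<le> s \<Longrightarrow> s \<le> t \<Longrightarrow> (\<integral>\<^sup>+\<omega>. ennreal ((norm (exp_increment \<theta> s t \<omega>))\<^sup>2) \<partial>M) < \<infinity>"
  using integrable_norm_exp_increment_powr[of s t \<theta> 2]
  by (auto simp: norm_exp_increment integrable_iff_bounded)

text \<open>Under the weight each increment counts as \<open>\<theta>\<close> times the length of
  its interval, and the length is the time integral of the indicator in the simple process. The
  right-hand side is an integral over a product space because it is there that integrands converge
  in the definition of the Ito integral.\<close>

lemma simple_ito_pairing:
  fixes \<theta> :: complex
  assumes t: "0 \<le> t" "t \<le> T" and simple: "simple_integrand F t n \<tau> \<xi>"
  defines "Z \<equiv> exp_increment \<theta> 0 T" and "R \<equiv> restrict_space lborel {0..t}"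
  shows "(\<lambda>(s, \<omega>). simple_process n \<tau> \<xi> s \<omega>) \<in> borel_measurable (R \<Otimes>\<^sub>M M)"
    and "simple_ito_integral w n \<tau> \<xi> \<in> borel_measurable M"
    and "integrable (R \<Otimes>\<^sub>M M) (\<lambda>(s, \<omega>). Z \<omega> * of_real (simple_process n \<tau> \<xi> s \<omega>))"
    and "integrable M (\<lambda>\<omega>. Z \<omega> * of_real (simple_ito_integral w n \<tau> \<xi> \<omega>))"
    and "(\<integral>\<omega>. Z \<omega> * of_real (simple_ito_integral w n \<tau> \<xi> \<omega>) \<partial>M) =
      \<theta> * (\<integral>(s, \<omega>). Z \<omega> * of_real (simple_process n \<tau> \<xi> s \<omega>) \<partial>(R \<Otimes>\<^sub>M M))"
proof -
  note times = simple_integrand_times[OF simple]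
  have R_emeasure: "emeasure R {\<tau> i<..\<tau> (Suc i)} = ennreal (\<tau> (Suc i) - \<tau> i)" if "i < n" for i
    using times[OF that] unfolding R_def by (subst emeasure_restrict_space) auto
  have fin_R: "finite_measure R"
    using t unfolding R_def by (intro finite_measureI) (simp add: space_restrict_space emeasure_restrict_space)
  then interpret R: finite_measure R .
  interpret P: pair_sigma_finite R M ..
  have \<xi>_F: "\<xi> i \<in> borel_measurable (F (\<tau> i))" if "i < n" for i
    using simple that by (simp add: simple_integrand_def)
  have \<xi>_M: "\<xi> i \<in> borel_measurable M" if "i < n" for i
    using \<xi>_F[OF that] measurable_F_M by blast
  have "\<exists>C. \<forall>\<omega>\<in>space M. \<bar>\<xi> i \<omega>\<bar> \<le> C" if "i < n" for i
    using simple that by (simp add: simple_integrand_def space_F)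
  then obtain C where C: "\<And>i \<omega>. i < n \<Longrightarrow> \<omega> \<in> space M \<Longrightarrow> \<bar>\<xi> i \<omega>\<bar> \<le> C i" by metis
  have ind [measurable]: "(\<lambda>s. indicat_real {\<tau> i<..\<tau> (Suc i)} s) \<in> borel_measurable R" for i
    unfolding R_def by (intro measurable_restrict_space1) simp
  have Z_int: "integrable M Z" and Z_M [measurable]: "Z \<in> borel_measurable M"
    unfolding Z_def using t by (auto intro!: integrable_exp_increment exp_increment_measurable)
  have Z\<xi>: "integrable M (\<lambda>\<omega>. Z \<omega> * of_real (\<xi> i \<omega>))" if "i < n" for i
  proof (rule Bochner_Integration.integrable_bound)
    show "integrable M (\<lambda>\<omega>. C i *\<^sub>R norm (Z \<omega>))" using Z_int by auto
    show "(\<lambda>\<omega>. Z \<omega> * of_real (\<xi> i \<omega>)) \<in> borel_measurable M"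
      using \<xi>_M[OF that] by measurable
    show "AE \<omega> in M. norm (Z \<omega> * of_real (\<xi> i \<omega>)) \<le> norm (C i *\<^sub>R norm (Z \<omega>))"
    proof (rule AE_I2)
      fix \<omega> assume "\<omega> \<in> space M"
      from C[OF that this] have "\<bar>\<xi> i \<omega>\<bar> \<le> \<bar>C i\<bar>" by linarith
      then show "norm (Z \<omega> * of_real (\<xi> i \<omega>)) \<le> norm (C i *\<^sub>R norm (Z \<omega>))"
        using mult_left_mono[OF _ norm_ge_zero[of "Z \<omega>"], of "\<bar>\<xi> i \<omega>\<bar>" "\<bar>C i\<bar>"]
        by (simp add: norm_mult abs_mult mult.commute)
    qed
  qed
  let ?p = "\<lambda>i s \<omega>. (Z \<omega> * of_real (\<xi> i \<omega>)) * of_real (indicat_real {\<tau> i<..\<tau> (Suc i)} s)"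
  have p_int: "integrable (R \<Otimes>\<^sub>M M) (case_prod (?p i))"
    and p_eq: "(\<integral>(s, \<omega>). ?p i s \<omega> \<partial>(R \<Otimes>\<^sub>M M)) = of_real (\<tau> (Suc i) - \<tau> i) * (\<integral>\<omega>. Z \<omega> * of_real (\<xi> i \<omega>) \<partial>M)"
    if i: "i < n" for i
  proof -
    have [measurable]: "\<xi> i \<in> borel_measurable M" using \<xi>_M[OF i] .
    have ind_int: "integrable R (\<lambda>s. indicat_real {\<tau> i<..\<tau> (Suc i)} s)"
      by (rule R.integrable_const_bound[where B = 1]) auto
    show p_int: "integrable (R \<Otimes>\<^sub>M M) (case_prod (?p i))"
    proof (rule P.Fubini_integrable)
      show "case_prod (?p i) \<in> borel_measurable (R \<Otimes>\<^sub>M M)" by measurable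
      show "AE s in R. integrable M (\<lambda>\<omega>. case_prod (?p i) (s, \<omega>))" using Z\<xi>[OF i] by auto
      show "integrable R (\<lambda>s. \<integral>\<omega>. norm (case_prod (?p i) (s, \<omega>)) \<partial>M)"
        using ind_int by (simp add: norm_mult integrable_mult_right)
    qed
    have "measure R {\<tau> i<..\<tau> (Suc i)} = \<tau> (Suc i) - \<tau> i"
      using R_emeasure[OF i] times[OF i] by (simp add: measure_def)
    moreover have "(\<integral>s. indicat_real {\<tau> i<..\<tau> (Suc i)} s \<partial>R) = measure R {\<tau> i<..\<tau> (Suc i)}"
    proof -
      have "{\<tau> i<..\<tau> (Suc i)} \<subseteq> space R"
        using times[OF i] by (auto simp: R_def space_restrict_space)
      then show ?thesis by (simp add: Int_absorb2)
    qed
    ultimately show "(\<integral>(s, \<omega>). ?p i s \<omega> \<partial>(R \<Otimes>\<^sub>M M)) = of_real (\<tau> (Suc i) - \<tau> i) * (\<integral>\<omega>. Z \<omega> * of_real (\<xi> i \<omega>) \<partial>M)"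
      unfolding P.integral_fst[OF p_int, symmetric]
      by (simp add: mult.commute)
  qed
  have sp: "(\<lambda>(s, \<omega>). Z \<omega> * of_real (simple_process n \<tau> \<xi> s \<omega>)) = (\<lambda>q. \<Sum>i<n. case_prod (?p i) q)"
    by (simp only: simple_process_def of_real_sum of_real_mult sum_distrib_left mult.assoc split_beta')
  show "(\<lambda>(s, \<omega>). simple_process n \<tau> \<xi> s \<omega>) \<in> borel_measurable (R \<Otimes>\<^sub>M M)"
    unfolding simple_process_def split_beta' using \<xi>_M
    by (intro borel_measurable_sum borel_measurable_times) (auto intro: measurable_compose[OF measurable_snd] measurable_compose[OF measurable_fst ind])
  show "simple_ito_integral w n \<tau> \<xi> \<in> borel_measurable M"
    unfolding simple_ito_integral_def[abs_def] using \<xi>_M times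
    by (intro borel_measurable_sum borel_measurable_times borel_measurable_diff wiener_measurable)
       (auto intro: order_trans)
  show "integrable (R \<Otimes>\<^sub>M M) (\<lambda>(s, \<omega>). Z \<omega> * of_real (simple_process n \<tau> \<xi> s \<omega>))"
    unfolding sp by (intro Bochner_Integration.integrable_sum p_int) simp
  have incr: "integrable M (\<lambda>\<omega>. Z \<omega> * (of_real (\<xi> i \<omega>) * of_real (w (\<tau> (Suc i)) \<omega> - w (\<tau> i) \<omega>)))"
      "(\<integral>\<omega>. Z \<omega> * (of_real (\<xi> i \<omega>) * of_real (w (\<tau> (Suc i)) \<omega> - w (\<tau> i) \<omega>)) \<partial>M) =
        \<theta> * of_real (\<tau> (Suc i) - \<tau> i) * (\<integral>\<omega>. Z \<omega> * of_real (\<xi> i \<omega>) \<partial>M)" if "i < n" for i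
    unfolding Z_def using times[OF that] t \<xi>_F[OF that] C[OF that]
    by (intro integrable_exp_increment_mult_increment[where C = "C i"]
              expectation_exp_increment_mult_increment[where C = "C i"]; simp)+
  have si: "(\<lambda>\<omega>. Z \<omega> * of_real (simple_ito_integral w n \<tau> \<xi> \<omega>)) =
      (\<lambda>\<omega>. \<Sum>i<n. Z \<omega> * (of_real (\<xi> i \<omega>) * of_real (w (\<tau> (Suc i)) \<omega> - w (\<tau> i) \<omega>)))"
    by (simp add: simple_ito_integral_def sum_distrib_left)
  show "integrable M (\<lambda>\<omega>. Z \<omega> * of_real (simple_ito_integral w n \<tau> \<xi> \<omega>))"
    unfolding si by (intro Bochner_Integration.integrable_sum incr) simp
  show "(\<integral>\<omega>. Z \<omega> * of_real (simple_ito_integral w n \<tau> \<xi> \<omega>) \<partial>M) =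
      \<theta> * (\<integral>(s, \<omega>). Z \<omega> * of_real (simple_process n \<tau> \<xi> s \<omega>) \<partial>(R \<Otimes>\<^sub>M M))"
    unfolding sp si using incr p_int p_eq
    by (simp add: Bochner_Integration.integral_sum sum_distrib_left mult.assoc)
qed

text \<open>The identity for simple integrands is passed to the limit: both sides are pairings with
  a square integrable weight, hence continuous for the two convergences defining the Ito integral.
  It holds for every version \<open>J\<close>.\<close>

lemma
  fixes \<theta> :: complex
  assumes t: "0 \<le> t" "t \<le> T" and ito: "has_ito_integral M F w t f J"
  defines "Z \<equiv> exp_increment \<theta> 0 T"
  shows integrable_exp_increment_mult_ito: "integrable M (\<lambda>\<omega>. Z \<omega> * of_real (J \<omega>))"
    and expectation_exp_increment_mult_ito:
      "(\<integral>\<omega>. Z \<omega> * of_real (J \<omega>) \<partial>M) = \<theta> * (LINT s:{0..t}|lborel. (\<integral>\<omega>. Z \<omega> * of_real (f s \<omega>) \<partial>M))"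
proof -
  define R where "R = restrict_space lborel {0..t}"
  have emeasure_R: "emeasure R (space R) = ennreal t"
    using t by (simp add: R_def space_restrict_space emeasure_restrict_space)
  then have "finite_measure R" by (intro finite_measureI) simp
  then interpret R: finite_measure R .
  interpret P: pair_sigma_finite R M ..
  have [measurable]: "J \<in> borel_measurable M" and prog: "progressive F t f"
    using ito by (auto simp: has_ito_integral_def)
  obtain n \<tau> \<xi> where simple: "\<And>k. simple_integrand F t (n k) (\<tau> k) (\<xi> k)"
    and lim_f: "(\<lambda>k. \<integral>\<^sup>+\<omega>. (\<integral>\<^sup>+s\<in>{0..t}. ennreal ((f s \<omega> - simple_process (n k) (\<tau> k) (\<xi> k) s \<omega>)\<^sup>2) \<partial>lborel) \<partial>M) \<longlonglongrightarrow> 0"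
    and lim_J: "(\<lambda>k. \<integral>\<^sup>+\<omega>. ennreal ((J \<omega> - simple_ito_integral w (n k) (\<tau> k) (\<xi> k) \<omega>)\<^sup>2) \<partial>M) \<longlonglongrightarrow> 0"
    using ito unfolding has_ito_integral_def by blast
  let ?\<phi> = "\<lambda>k. simple_process (n k) (\<tau> k) (\<xi> k)" and ?I = "\<lambda>k. simple_ito_integral w (n k) (\<tau> k) (\<xi> k)"
  note S_M [measurable] = simple_ito_pairing(1,2)[OF t simple, folded R_def]
  note S = simple_ito_pairing(3-5)[OF t simple, where \<theta> = \<theta>, folded Z_def R_def]
  have [measurable]: "(\<lambda>(s, \<omega>). f s \<omega>) \<in> borel_measurable (R \<Otimes>\<^sub>M M)"
    unfolding R_def by (rule progressive_measurable[OF prog t(1)])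
  have Z_M [measurable]: "Z \<in> borel_measurable M"
    unfolding Z_def using t by (auto intro!: exp_increment_measurable)
  have Z_L2: "(\<integral>\<^sup>+\<omega>. ennreal ((norm (Z \<omega>))\<^sup>2) \<partial>M) < \<infinity>"
    unfolding Z_def using t exp_increment_L2[of 0 T \<theta>] by simp
  have "(\<integral>\<^sup>+q. ennreal ((norm (Z (snd q)))\<^sup>2) \<partial>(R \<Otimes>\<^sub>M M)) = (\<integral>\<^sup>+s. (\<integral>\<^sup>+\<omega>. ennreal ((norm (Z \<omega>))\<^sup>2) \<partial>M) \<partial>R)"
    by (subst nn_integral_fst[symmetric]) auto
  also have "\<dots> < \<infinity>"
    using Z_L2 by (simp add: emeasure_R ennreal_mult_less_top)
  finally have Z_L2': "(\<integral>\<^sup>+q. ennreal ((norm (Z (snd q)))\<^sup>2) \<partial>(R \<Otimes>\<^sub>M M)) < \<infinity>" .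
  let ?d = "\<lambda>k q. f (fst q) (snd q) - ?\<phi> k (fst q) (snd q)"
  have d_M [measurable]: "?d k \<in> borel_measurable (R \<Otimes>\<^sub>M M)" for k
    using S_M(1)[of k] by (simp add: split_beta')
  \<comment> \<open>The definition of the Ito integral integrates over time first; Tonelli's theorem
    turns this into the squared distance on the product space.\<close>
  have "(\<integral>\<^sup>+q. ennreal ((?d k q)\<^sup>2) \<partial>(R \<Otimes>\<^sub>M M)) =
      (\<integral>\<^sup>+\<omega>. (\<integral>\<^sup>+s\<in>{0..t}. ennreal ((f s \<omega> - ?\<phi> k s \<omega>)\<^sup>2) \<partial>lborel) \<partial>M)" for k
  proof -
    have "(\<integral>\<^sup>+q. ennreal ((?d k q)\<^sup>2) \<partial>(R \<Otimes>\<^sub>M M)) = (\<integral>\<^sup>+\<omega>. (\<integral>\<^sup>+s. ennreal ((f s \<omega> - ?\<phi> k s \<omega>)\<^sup>2) \<partial>R) \<partial>M)"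
      by (subst P.nn_integral_snd[symmetric]) auto
    then show ?thesis
      by (simp add: R_def nn_integral_restrict_space)
  qed
  with lim_f have lim_d: "(\<lambda>k. \<integral>\<^sup>+q. ennreal ((?d k q)\<^sup>2) \<partial>(R \<Otimes>\<^sub>M M)) \<longlonglongrightarrow> 0" by simp
  have conv1: "(\<lambda>k. \<integral>q. Z (snd q) * of_real (?d k q) \<partial>(R \<Otimes>\<^sub>M M)) \<longlonglongrightarrow> 0"
    by (rule integral_L2_mult_tendsto_0[OF _ _ Z_L2' lim_d]) auto
  have conv2: "(\<lambda>k. \<integral>\<omega>. Z \<omega> * of_real (J \<omega> - ?I k \<omega>) \<partial>M) \<longlonglongrightarrow> 0"
    by (rule integral_L2_mult_tendsto_0[OF _ _ Z_L2 lim_J]) auto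
  \<comment> \<open>The squared distances tend to 0, so from some index on they are below 1, in
    particular finite; earlier ones may be infinite.\<close>
  have "eventually (\<lambda>k. integrable (R \<Otimes>\<^sub>M M) (\<lambda>q. Z (snd q) * of_real (?d k q)) \<and>
      integrable M (\<lambda>\<omega>. Z \<omega> * of_real (J \<omega> - ?I k \<omega>))) sequentially"
    using order_tendstoD(2)[OF lim_d zero_less_one] order_tendstoD(2)[OF lim_J zero_less_one]
  proof eventually_elim
    case (elim k)
    then show ?case
      by (intro conjI integrable_L2_mult Z_L2 Z_L2') (auto intro: less_trans[OF _ ennreal_one_less_top])
  qed
  moreover
  { fix k
    assume k: "integrable (R \<Otimes>\<^sub>M M) (\<lambda>q. Z (snd q) * of_real (?d k q))"
      "integrable M (\<lambda>\<omega>. Z \<omega> * of_real (J \<omega> - ?I k \<omega>))"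
    have S3: "integrable (R \<Otimes>\<^sub>M M) (\<lambda>q. Z (snd q) * of_real (?\<phi> k (fst q) (snd q)))"
      using S(1)[of k] by (simp add: split_beta')
    have eq: "(\<lambda>q. Z (snd q) * of_real (?d k q) + Z (snd q) * of_real (?\<phi> k (fst q) (snd q))) =
        (\<lambda>q. Z (snd q) * of_real (f (fst q) (snd q)))"
        "(\<lambda>\<omega>. Z \<omega> * of_real (J \<omega> - ?I k \<omega>) + Z \<omega> * of_real (?I k \<omega>)) = (\<lambda>\<omega>. Z \<omega> * of_real (J \<omega>))"
      by (auto simp: algebra_simps)
    note add = Bochner_Integration.integrable_add[OF k(1) S3, unfolded eq]
      Bochner_Integration.integrable_add[OF k(2) S(2)[of k], unfolded eq]
    have add_eq: "(\<integral>\<omega>. Z \<omega> * of_real (J \<omega>) \<partial>M) =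
        (\<integral>\<omega>. Z \<omega> * of_real (J \<omega> - ?I k \<omega>) \<partial>M) + \<theta> * (\<integral>q. Z (snd q) * of_real (?\<phi> k (fst q) (snd q)) \<partial>(R \<Otimes>\<^sub>M M))"
      "(\<integral>q. Z (snd q) * of_real (f (fst q) (snd q)) \<partial>(R \<Otimes>\<^sub>M M)) =
        (\<integral>q. Z (snd q) * of_real (?d k q) \<partial>(R \<Otimes>\<^sub>M M)) + (\<integral>q. Z (snd q) * of_real (?\<phi> k (fst q) (snd q)) \<partial>(R \<Otimes>\<^sub>M M))"
      using Bochner_Integration.integral_add[OF k(2) S(2)[of k], unfolded eq S(3)[of k]]
        Bochner_Integration.integral_add[OF k(1) S3, unfolded eq] by (simp_all only: split_beta')
    \<comment> \<open>The contributions of the simple process cancel, since the identity is already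
      known for it. What remains on the right involves the approximation errors alone.\<close>
    have "integrable (R \<Otimes>\<^sub>M M) (\<lambda>q. Z (snd q) * of_real (f (fst q) (snd q))) \<and>
        integrable M (\<lambda>\<omega>. Z \<omega> * of_real (J \<omega>)) \<and>
        (\<integral>\<omega>. Z \<omega> * of_real (J \<omega>) \<partial>M) - \<theta> * (\<integral>q. Z (snd q) * of_real (f (fst q) (snd q)) \<partial>(R \<Otimes>\<^sub>M M)) =
        (\<integral>\<omega>. Z \<omega> * of_real (J \<omega> - ?I k \<omega>) \<partial>M) - \<theta> * (\<integral>q. Z (snd q) * of_real (?d k q) \<partial>(R \<Otimes>\<^sub>M M))"
      using add unfolding add_eq by (simp only: distrib_left add_diff_add diff_self add_0_right simp_thms) }
  note decomp = this
  ultimately have ev: "eventually (\<lambda>k. integrable (R \<Otimes>\<^sub>M M) (\<lambda>q. Z (snd q) * of_real (f (fst q) (snd q))) \<and>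
        integrable M (\<lambda>\<omega>. Z \<omega> * of_real (J \<omega>)) \<and>
        (\<integral>\<omega>. Z \<omega> * of_real (J \<omega>) \<partial>M) - \<theta> * (\<integral>q. Z (snd q) * of_real (f (fst q) (snd q)) \<partial>(R \<Otimes>\<^sub>M M)) =
        (\<integral>\<omega>. Z \<omega> * of_real (J \<omega> - ?I k \<omega>) \<partial>M) - \<theta> * (\<integral>q. Z (snd q) * of_real (?d k q) \<partial>(R \<Otimes>\<^sub>M M))) sequentially"
    by (auto elim: eventually_mono)
  then obtain k0 where int_f: "integrable (R \<Otimes>\<^sub>M M) (\<lambda>q. Z (snd q) * of_real (f (fst q) (snd q)))"
    and int_J: "integrable M (\<lambda>\<omega>. Z \<omega> * of_real (J \<omega>))"
    unfolding eventually_sequentially by blast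
  show "integrable M (\<lambda>\<omega>. Z \<omega> * of_real (J \<omega>))" by (rule int_J)
  \<comment> \<open>This defect does not depend on \<open>k\<close>, yet for large \<open>k\<close>
    it equals the \<open>k\<close>-th term of a sequence tending to 0.\<close>
  let ?c = "(\<integral>\<omega>. Z \<omega> * of_real (J \<omega>) \<partial>M) - \<theta> * (\<integral>q. Z (snd q) * of_real (f (fst q) (snd q)) \<partial>(R \<Otimes>\<^sub>M M))"
  have "(\<lambda>k. (\<integral>\<omega>. Z \<omega> * of_real (J \<omega> - ?I k \<omega>) \<partial>M) - \<theta> * (\<integral>q. Z (snd q) * of_real (?d k q) \<partial>(R \<Otimes>\<^sub>M M)))
      \<longlonglongrightarrow> 0 - \<theta> * 0"
    by (intro tendsto_intros conv1 conv2)
  then have "(\<lambda>k. ?c) \<longlonglongrightarrow> 0 - \<theta> * 0"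
    by (rule Lim_transform_eventually) (use ev in \<open>auto elim: eventually_mono\<close>)
  then have "?c = 0" by (simp add: LIMSEQ_const_iff)
  moreover have "(\<integral>q. Z (snd q) * of_real (f (fst q) (snd q)) \<partial>(R \<Otimes>\<^sub>M M)) =
      (LINT s:{0..t}|lborel. (\<integral>\<omega>. Z \<omega> * of_real (f s \<omega>) \<partial>M))"
    using P.integral_fst[of "\<lambda>s \<omega>. Z \<omega> * of_real (f s \<omega>)"] int_f
    by (simp add: set_integral_eq_restrict_space R_def split_beta')
  ultimately show "(\<integral>\<omega>. Z \<omega> * of_real (J \<omega>) \<partial>M) =
      \<theta> * (LINT s:{0..t}|lborel. (\<integral>\<omega>. Z \<omega> * of_real (f s \<omega>) \<partial>M))"
    by simp
qed

end

section \<open>Functions on the torus\<close>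

text \<open>Only integrability is known of a weighted expectation as a function of time. The
  equation itself improves this: an indefinite integral is continuous, so \<open>m\<close> is
  continuous, and then the integral is differentiable.\<close>

lemma linear_integral_equation_unique:
  fixes m :: "real \<Rightarrow> complex"
  assumes T: "0 \<le> T"
    and int: "set_integrable lborel {0..T} m"
    and eq: "\<And>t. t \<in> {0..T} \<Longrightarrow> m t = x0 + c * (LINT s:{0..t}|lborel. m s)"
  shows "m T = x0 * exp (c * of_real T)"
proof -
  have int_t: "set_integrable lborel {0..t} m" if "t \<in> {0..T}" for t
    by (rule set_integrable_subset[OF int]) (use that in auto)
  have eq': "m t = x0 + c * integral {0..t} m" if "t \<in> {0..T}" for t
    using eq[OF that] set_borel_integral_eq_integral(2)[OF int_t[OF that]] by simp
  have "m integrable_on {0..T}"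
    using set_borel_integral_eq_integral(1)[OF int] .
  then have "continuous_on {0..T} (\<lambda>t. x0 + c * integral {0..t} m)"
    by (intro continuous_intros indefinite_integral_continuous_1)
  then have cont: "continuous_on {0..T} m"
    by (rule continuous_on_eq) (use eq' in auto)
  have m': "(m has_vector_derivative c * m t) (at t within {0..T})" if "t \<in> {0..T}" for t
  proof -
    have "((\<lambda>t. x0 + c * integral {0..t} m) has_vector_derivative 0 + c * m t) (at t within {0..T})"
      by (intro has_vector_derivative_add has_vector_derivative_const has_vector_derivative_mult_right
            integral_has_vector_derivative cont that)
    then show ?thesis
      using has_vector_derivative_transform[OF that, of m] eq' by simp
  qed
  \<comment> \<open>Integrating factor: the product has derivative 0 and is therefore
    constant.\<close>
  obtain k where k: "\<And>t. t \<in> {0..T} \<Longrightarrow> m t * exp (- c * of_real t) = k"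
  proof (rule has_vector_derivative_zero_constant[OF convex_real_interval(5)])
    fix t assume "t \<in> {0..T}"
    have "((\<lambda>z. exp (- c * z)) has_field_derivative exp (- c * of_real t) * (- c)) (at (complex_of_real t))"
      by (auto intro!: derivative_eq_intros)
    then have "((\<lambda>t. exp (- c * complex_of_real t)) has_vector_derivative exp (- c * of_real t) * (- c))
        (at t within {0..T})"
      using has_vector_derivative_real_field has_vector_derivative_at_within by blast
    from has_vector_derivative_mult[OF m'[OF \<open>t \<in> {0..T}\<close>] this]
    show "((\<lambda>t. m t * exp (- c * of_real t)) has_vector_derivative 0) (at t within {0..T})"
      by (simp add: algebra_simps)
  qed blast
  have "m 0 = x0" using eq'[of 0] T by simp
  then have "m T * exp (- c * of_real T) = x0" using k[of 0] k[of T] T by simp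
  then show ?thesis by (simp add: exp_minus field_simps)
qed

section \<open>Inner product and Cauchy-Schwarz inequality on the torus\<close>

lemma L2_torus_product_integrable:
  assumes "f \<in> L2_torus" "g \<in> L2_torus"
  shows "set_integrable lborel {0..2 * pi} (\<lambda>x. f x * g x)"
proof -
  have [measurable]: "f \<in> borel_measurable borel" "g \<in> borel_measurable borel"
    using assms by (auto simp: L2_torus_def)
  have "set_integrable lborel {0..2 * pi} (\<lambda>x. (f x)\<^sup>2 + (g x)\<^sup>2)"
    using assms by (intro set_integral_add(1)) (auto simp: L2_torus_def)
  then show ?thesis
  proof (rule set_integrable_bound)
    have "\<bar>f x * g x\<bar> \<le> (f x)\<^sup>2 + (g x)\<^sup>2" for x
    proof -
      have "0 \<le> \<bar>f x\<bar> * \<bar>g x\<bar>" by simp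
      with sum_squares_bound[of "\<bar>f x\<bar>" "\<bar>g x\<bar>"] show ?thesis
        unfolding abs_mult power2_abs by linarith
    qed
    then show "AE x in lborel. x \<in> {0..2 * pi} \<longrightarrow> norm (f x * g x) \<le> norm ((f x)\<^sup>2 + (g x)\<^sup>2)"
      by simp
  qed (simp add: set_borel_measurable_def)
qed

lemma torus_inner_linear_combination:
  assumes "f \<in> L2_torus" "g \<in> L2_torus" "h \<in> L2_torus"
  shows "torus_inner (\<lambda>x. a * f x + b * g x) h = a * torus_inner f h + b * torus_inner g h"
proof -
  note [simp] = L2_torus_product_integrable[OF assms(1,3)] L2_torus_product_integrable[OF assms(2,3)]
  have "torus_inner (\<lambda>x. a * f x + b * g x) h =
      (LINT x:{0..2*pi}|lborel. a * (f x * h x) + b * (g x * h x))"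
    by (simp add: torus_inner_def algebra_simps)
  also have "\<dots> = a * torus_inner f h + b * torus_inner g h"
    unfolding torus_inner_def
    by (subst set_integral_add(2)) (auto intro: set_integrable_mult_right)
  finally show ?thesis .
qed

lemma torus_inner_scale: "torus_inner f (\<lambda>x. c * g x) = c * torus_inner f g"
  by (simp add: torus_inner_def mult.left_commute)

lemma torus_inner_self_nonneg: "0 \<le> torus_inner f f"
  unfolding torus_inner_def set_lebesgue_integral_def
  by (intro Bochner_Integration.integral_nonneg) auto

lemma torus_Cauchy_Schwarz:
  assumes "f \<in> L2_torus" "g \<in> L2_torus"
  shows "\<bar>torus_inner f g\<bar> \<le> L2_torus_norm f * L2_torus_norm g"
proof -
  let ?I = "restrict_space lborel {0..2 * pi}"
  have [measurable]: "f \<in> borel_measurable borel" "g \<in> borel_measurable borel"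
    using assms by (auto simp: L2_torus_def)
  have nn: "(\<integral>\<^sup>+x. ennreal ((k x)\<^sup>2) \<partial>?I) = ennreal (torus_inner k k)" if "k \<in> L2_torus" for k
    using that L2_torus_product_integrable[OF that that]
    by (subst nn_integral_eq_integral)
       (auto simp: torus_inner_def set_lebesgue_integral_def integral_restrict_space power2_eq_square
         set_integrable_def integrable_restrict_space)
  have fg: "integrable ?I (\<lambda>x. f x * g x)"
    using L2_torus_product_integrable[OF assms] by (simp add: set_integrable_def integrable_restrict_space)
  have "ennreal ((torus_inner f g)\<^sup>2) \<le> (\<integral>\<^sup>+x. ennreal \<bar>f x\<bar> * ennreal \<bar>g x\<bar> \<partial>?I)\<^sup>2"
  proof -
    have "torus_inner f g = (\<integral>x. f x * g x \<partial>?I)"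
      by (simp add: torus_inner_def set_lebesgue_integral_def integral_restrict_space)
    then have "ennreal \<bar>torus_inner f g\<bar> \<le> (\<integral>\<^sup>+x. ennreal \<bar>f x * g x\<bar> \<partial>?I)"
      using integral_norm_bound_ennreal[OF fg] by simp
    then have "(ennreal \<bar>torus_inner f g\<bar>)\<^sup>2 \<le> (\<integral>\<^sup>+x. ennreal \<bar>f x * g x\<bar> \<partial>?I)\<^sup>2"
      by (intro power_mono) auto
    then show ?thesis by (simp add: ennreal_power abs_mult ennreal_mult)
  qed
  also have "\<dots> \<le> (\<integral>\<^sup>+x. (ennreal \<bar>f x\<bar>)\<^sup>2 \<partial>?I) * (\<integral>\<^sup>+x. (ennreal \<bar>g x\<bar>)\<^sup>2 \<partial>?I)"
    by (intro Cauchy_Schwarz_nn_integral measurable_restrict_space1) auto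
  also have "\<dots> = ennreal (torus_inner f f * torus_inner g g)"
    by (simp add: ennreal_power nn assms ennreal_mult torus_inner_self_nonneg)
  finally have "(torus_inner f g)\<^sup>2 \<le> torus_inner f f * torus_inner g g"
    by (simp add: torus_inner_self_nonneg)
  then have "sqrt ((torus_inner f g)\<^sup>2) \<le> sqrt (torus_inner f f * torus_inner g g)"
    by (rule real_sqrt_le_mono)
  then show ?thesis by (simp add: L2_torus_norm_def real_sqrt_mult)
qed

section \<open>Cosine and sine as test functions\<close>

lemma deriv_iter_cos_sin:
  "\<exists>a' b'. (deriv ^^ k) (\<lambda>x::real. a * cos (n * x) + b * sin (n * x)) = (\<lambda>x. a' * cos (n * x) + b' * sin (n * x))"
proof (induction k)
  case (Suc k)
  then obtain a' b' where IH: "(deriv ^^ k) (\<lambda>x::real. a * cos (n * x) + b * sin (n * x)) =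
      (\<lambda>x. a' * cos (n * x) + b' * sin (n * x))" by blast
  \<comment> \<open>The span of the cosine and sine of one frequency is closed under
    differentiation, which is why the induction carries two unspecified coefficients.\<close>
  have "deriv (\<lambda>x. a' * cos (n * x) + b' * sin (n * x)) = (\<lambda>x. (n * b') * cos (n * x) + (- n * a') * sin (n * x))"
    by (rule ext, rule DERIV_imp_deriv) (auto intro!: derivative_eq_intros simp: algebra_simps)
  with IH show ?case
    by (intro exI[of _ "n * b'"] exI[of _ "- n * a'"]) simp
qed auto

lemma cos_sin_smooth_torus:
  "(\<lambda>x. a * cos (real n * x) + b * sin (real n * x)) \<in> smooth_torus"
proof -
  have "cos (real n * (x + 2 * pi)) = cos (real n * x)" "sin (real n * (x + 2 * pi)) = sin (real n * x)" for x
  proof -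
    have "real n * (x + 2 * pi) = real n * x + 2 * real n * pi" by (simp add: algebra_simps)
    then show "cos (real n * (x + 2 * pi)) = cos (real n * x)" "sin (real n * (x + 2 * pi)) = sin (real n * x)"
      by (simp_all only: cos_add sin_add cos_2npi sin_2npi)
  qed
  moreover have "(deriv ^^ k) (\<lambda>x. a * cos (real n * x) + b * sin (real n * x)) differentiable (at x)" for k x
  proof -
    obtain a' b' where "(deriv ^^ k) (\<lambda>x. a * cos (real n * x) + b * sin (real n * x)) =
        (\<lambda>x. a' * cos (real n * x) + b' * sin (real n * x))"
      using deriv_iter_cos_sin by blast
    moreover have "(\<lambda>x. a' * cos (real n * x) + b' * sin (real n * x)) differentiable (at x)"
      unfolding real_differentiable_def
      by (rule exI[of _ "- (a' * (sin (real n * x) * real n)) + b' * (cos (real n * x) * real n)"])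
         (auto intro!: derivative_eq_intros)
    ultimately show ?thesis by (simp only:)
  qed
  ultimately show ?thesis by (simp add: smooth_torus_def)
qed

lemma
  shows cos_smooth_torus: "(\<lambda>x. cos (real n * x)) \<in> smooth_torus"
    and sin_smooth_torus: "(\<lambda>x. sin (real n * x)) \<in> smooth_torus"
  using cos_sin_smooth_torus[of 1 n 0] cos_sin_smooth_torus[of 0 n 1] by simp_all

lemma continuous_periodic_L2_torus:
  assumes "continuous_on UNIV f" "\<And>x. f (x + 2 * pi) = f x"
  shows "f \<in> L2_torus"
proof -
  have "set_integrable lborel {0..2 * pi} (\<lambda>x. (f x)\<^sup>2)"
    by (intro borel_integrable_atLeastAtMost' continuous_intros continuous_on_subset[OF assms(1)]) auto
  then show ?thesis using assms by (simp add: L2_torus_def borel_measurable_continuous_onI)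
qed

lemma smooth_torus_subset_L2_torus: "smooth_torus \<subseteq> L2_torus"
proof
  fix f assume f: "f \<in> smooth_torus"
  then have "f differentiable (at x)" for x
  proof -
    have "(deriv ^^ 0) f differentiable (at x)" using f unfolding smooth_torus_def by blast
    then show ?thesis by simp
  qed
  then have "continuous_on UNIV f"
    by (simp add: continuous_on_eq_continuous_at differentiable_imp_continuous_within)
  then show "f \<in> L2_torus"
    using f by (intro continuous_periodic_L2_torus) (auto simp: smooth_torus_def)
qed

lemmas trig_L2_torus =
  subsetD[OF smooth_torus_subset_L2_torus cos_smooth_torus] subsetD[OF smooth_torus_subset_L2_torus sin_smooth_torus]

text \<open>Both functions are bounded by 1 on an interval of length \<open>2 * pi\<close>. What
  matters later is that the bound is independent of \<open>n\<close>.\<close>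

lemma trig_norm_le:
  "L2_torus_norm (\<lambda>x. cos (real n * x)) \<le> sqrt (2 * pi)" "L2_torus_norm (\<lambda>x. sin (real n * x)) \<le> sqrt (2 * pi)"
proof -
  have "torus_inner f f \<le> 2 * pi" if f: "f \<in> L2_torus" and le: "\<And>x. \<bar>f x\<bar> \<le> 1" for f
  proof -
    have "f x * f x \<le> 1" for x
      using le[of x] by (metis abs_mult_self_eq abs_ge_zero mult_le_one)
    then have "torus_inner f f \<le> (LINT x:{0..2*pi}|lborel. 1)"
      unfolding torus_inner_def
      by (intro set_integral_mono L2_torus_product_integrable f) (auto simp: set_integrable_def)
    then show ?thesis by (simp add: set_lebesgue_integral_def)
  qed
  from this[OF trig_L2_torus(1)] this[OF trig_L2_torus(2)]
  show "L2_torus_norm (\<lambda>x. cos (real n * x)) \<le> sqrt (2 * pi)" "L2_torus_norm (\<lambda>x. sin (real n * x)) \<le> sqrt (2 * pi)"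
    by (simp_all add: L2_torus_norm_def)
qed

section \<open>Weak derivatives against cosine and sine\<close>

lemma weak_deriv_works:
  assumes "f \<in> sobolev_torus m" "k \<le> m"
  shows "has_weak_deriv k f (weak_deriv k f)"
  using assms someI_ex[of "has_weak_deriv k f"] unfolding weak_deriv_def sobolev_torus_def by auto

lemma sobolev_torus_L2: "f \<in> sobolev_torus m \<Longrightarrow> f \<in> L2_torus"
  unfolding sobolev_torus_def has_weak_deriv_def by blast

lemma weak_deriv_L2: "f \<in> sobolev_torus m \<Longrightarrow> k \<le> m \<Longrightarrow> weak_deriv k f \<in> L2_torus"
  using weak_deriv_works unfolding has_weak_deriv_def by blast

text \<open>The derivatives are moved to the test function, which stays within its own frequency.
  This is why the system decouples into closed systems, one for each frequency.\<close>

lemma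
  assumes f: "f \<in> sobolev_torus 2"
  shows torus_inner_weak_deriv_1_cos:
      "torus_inner (weak_deriv 1 f) (\<lambda>x. cos (real n * x)) = real n * torus_inner f (\<lambda>x. sin (real n * x))"
    and torus_inner_weak_deriv_1_sin:
      "torus_inner (weak_deriv 1 f) (\<lambda>x. sin (real n * x)) = - real n * torus_inner f (\<lambda>x. cos (real n * x))"
    and torus_inner_weak_deriv_2_cos:
      "torus_inner (weak_deriv 2 f) (\<lambda>x. cos (real n * x)) = - (real n)\<^sup>2 * torus_inner f (\<lambda>x. cos (real n * x))"
    and torus_inner_weak_deriv_2_sin:
      "torus_inner (weak_deriv 2 f) (\<lambda>x. sin (real n * x)) = - (real n)\<^sup>2 * torus_inner f (\<lambda>x. sin (real n * x))"
proof -
  let ?c = "\<lambda>x. cos (real n * x)" and ?s = "\<lambda>x. sin (real n * x)"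
  have dc: "deriv ?c = (\<lambda>x. - real n * ?s x)" and ds: "deriv ?s = (\<lambda>x. real n * ?c x)"
    by (rule ext, rule DERIV_imp_deriv, auto intro!: derivative_eq_intros)+
  have dc2: "deriv (\<lambda>x. - real n * ?s x) = (\<lambda>x. - (real n)\<^sup>2 * ?c x)"
    and ds2: "deriv (\<lambda>x. real n * ?c x) = (\<lambda>x. - (real n)\<^sup>2 * ?s x)"
    by (rule ext, rule DERIV_imp_deriv, auto intro!: derivative_eq_intros simp: power2_eq_square)+
  have eq: "torus_inner f ((deriv ^^ k) \<phi>) = (-1) ^ k * torus_inner (weak_deriv k f) \<phi>"
    if "k \<le> 2" "\<phi> \<in> smooth_torus" for k \<phi>
    using weak_deriv_works[OF f that(1)] that(2) unfolding has_weak_deriv_def by blast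
  show "torus_inner (weak_deriv 1 f) ?c = real n * torus_inner f ?s"
    using eq[of 1 ?c] torus_inner_scale[of f "- real n" ?s] cos_smooth_torus[of n] by (simp add: dc)
  show "torus_inner (weak_deriv 1 f) ?s = - real n * torus_inner f ?c"
    using eq[of 1 ?s] torus_inner_scale[of f "real n" ?c] sin_smooth_torus[of n] by (simp add: ds)
  have ddc: "(deriv ^^ 2) ?c = (\<lambda>x. - (real n)\<^sup>2 * ?c x)" and dds: "(deriv ^^ 2) ?s = (\<lambda>x. - (real n)\<^sup>2 * ?s x)"
    by (simp_all only: numeral_2_eq_2 funpow.simps comp_apply id_apply dc dc2[unfolded numeral_2_eq_2]
          ds ds2[unfolded numeral_2_eq_2])
  show "torus_inner (weak_deriv 2 f) ?c = - (real n)\<^sup>2 * torus_inner f ?c"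
    using eq[OF order_refl cos_smooth_torus[of n]] unfolding ddc torus_inner_scale by simp
  show "torus_inner (weak_deriv 2 f) ?s = - (real n)\<^sup>2 * torus_inner f ?s"
    using eq[OF order_refl sin_smooth_torus[of n]] unfolding dds torus_inner_scale by simp
qed

text \<open>\<open>sobolev_norm 0\<close> is computed from \<open>weak_deriv 0 f\<close>, a chosen
  function that may differ from \<open>f\<close>. The defining property of a weak derivative of
  order 0 says that smooth \<open>g\<close> cannot tell the two apart.\<close>

lemma torus_inner_le_sobolev_norm:
  assumes f: "f \<in> sobolev_torus 0" and g: "g \<in> smooth_torus"
  shows "\<bar>torus_inner f g\<bar> \<le> sobolev_norm 0 f * L2_torus_norm g"
proof -
  have "torus_inner f g = torus_inner (weak_deriv 0 f) g"
    using weak_deriv_works[OF f order_refl] g unfolding has_weak_deriv_def by simp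
  moreover have "sobolev_norm 0 f = L2_torus_norm (weak_deriv 0 f)"
    by (simp add: sobolev_norm_def L2_torus_norm_def torus_inner_self_nonneg)
  ultimately show ?thesis
    using torus_Cauchy_Schwarz[OF weak_deriv_L2[OF f order_refl], of g] g smooth_torus_subset_L2_torus by auto
qed

section \<open>Fourier coefficients of the initial datum\<close>

lemma integral_exp_int_period:
  "(LINT x:{0..2 * pi}|lborel. exp (\<i> * complex_of_real (real_of_int j * x))) = (if j = 0 then 2 * pi else 0)"
proof (cases "j = 0")
  case True
  then have "(LINT x:{0..2 * pi}|lborel. exp (\<i> * complex_of_real (real_of_int j * x))) =
      (LINT x:{0..2 * pi}|lborel. complex_of_real 1)" by simp
  then show ?thesis unfolding set_integral_complex_of_real using True by (simp add: set_lebesgue_integral_def)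
next
  case False
  let ?F = "\<lambda>x. exp (\<i> * complex_of_real (real_of_int j * x)) / (\<i> * of_int j)"
  have "(\<integral>x. indicator {0..2 * pi} x *\<^sub>R exp (\<i> * complex_of_real (real_of_int j * x)) \<partial>lborel) = ?F (2 * pi) - ?F 0"
  proof (rule integral_FTC_Icc)
    fix x :: real
    have "((\<lambda>z. exp (\<i> * (of_int j * z)) / (\<i> * of_int j)) has_field_derivative
        exp (\<i> * (of_int j * of_real x)) * (\<i> * (of_int j * 1)) / (\<i> * of_int j)) (at (complex_of_real x))"
      by (intro DERIV_cdivide DERIV_fun_exp DERIV_cmult DERIV_ident)
    then have "((\<lambda>z. exp (\<i> * (of_int j * z)) / (\<i> * of_int j)) has_field_derivative
        exp (\<i> * (of_int j * of_real x))) (at (complex_of_real x))"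
      using False by simp
    then have "((\<lambda>x. exp (\<i> * (of_int j * of_real x)) / (\<i> * of_int j)) has_vector_derivative
        exp (\<i> * (of_int j * of_real x))) (at x)"
      by (rule has_vector_derivative_real_field)
    from has_vector_derivative_at_within[OF this]
    show "(?F has_vector_derivative exp (\<i> * complex_of_real (real_of_int j * x))) (at x within {0..2 * pi})"
      by simp
  qed (auto intro!: continuous_intros)
  moreover have "exp (\<i> * complex_of_real (real_of_int j * (2 * pi))) = 1"
    using cis_multiple_2pi[of "real_of_int j"] unfolding cis_conv_exp
    by (simp only: Ints_of_int mult.commute[of "real_of_int j"])
  ultimately show ?thesis using False by (simp add: set_lebesgue_integral_def)
qed

text \<open>The enumeration of the integers satisfies
  \<open>k \<le> 2 * \<bar>int_decode k\<bar> + 1\<close>, and an integer is at most its square in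
  modulus, so the terms are dominated by a geometric series of ratio \<open>exp (- (1/2))\<close>.
  The prefactor \<open>exp 1\<close> rounds up \<open>exp (1/2)\<close>.\<close>

lemma summable_exp_minus_square_int_decode: "summable (\<lambda>k. exp (- (real_of_int (int_decode k))\<^sup>2))"
proof (rule summable_comparison_test')
  show "summable (\<lambda>k. exp 1 * exp (- (1/2)) ^ k :: real)"
    by (intro summable_mult summable_geometric) simp
  fix k :: nat
  let ?j = "int_decode k"
  have "int k \<le> 2 * \<bar>?j\<bar> + 1"
  proof (cases "even k")
    case True
    then show ?thesis by (simp add: int_decode_def sum_decode_def)
  next
    case False
    then show ?thesis by (simp add: int_decode_def sum_decode_def)
  qed
  moreover have "\<bar>?j\<bar> \<le> ?j\<^sup>2"
  proof (cases "?j = 0")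
    case False
    then have "\<bar>?j\<bar> * 1 \<le> \<bar>?j\<bar> * \<bar>?j\<bar>" by (intro mult_left_mono) auto
    then show ?thesis by (simp add: power2_eq_square)
  qed simp
  ultimately have "int k \<le> 2 * ?j\<^sup>2 + 1" by linarith
  then have "real_of_int (int k) \<le> real_of_int (2 * ?j\<^sup>2 + 1)"
    by (simp only: of_int_le_iff)
  then have "real k \<le> 2 * (real_of_int ?j)\<^sup>2 + 1" by simp
  then have "exp (- (real_of_int ?j)\<^sup>2) \<le> exp (1 + real k * (- (1/2)))" by simp
  also have "\<dots> = exp 1 * exp (- (1/2)) ^ k"
    unfolding exp_of_nat_mult[symmetric] exp_add[symmetric] ..
  finally show "norm (exp (- (real_of_int ?j)\<^sup>2)) \<le> exp 1 * exp (- (1/2)) ^ k" by simp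
qed

lemma set_integrable_complex_of_real:
  assumes "set_integrable M A f"
  shows "set_integrable M A (\<lambda>x. complex_of_real (f x))"
  using integrable_of_real[OF assms[unfolded set_integrable_def], where 'a = complex]
  by (simp add: set_integrable_def scaleR_conv_of_real)

text \<open>The left-hand side is the integral of (f + i g) exp (- i n x) over a period. The series
  converges absolutely and uniformly in x, so it may be integrated term by term, and orthogonality
  keeps only frequency n. The factor \<open>2 * pi\<close> stays because the coefficient is not
  normalised.\<close>

lemma gaussian_fourier_coefficient:
  assumes f: "f \<in> L2_torus" and g: "g \<in> L2_torus"
    and series: "AE x in lborel. complex_of_real (f x) + \<i> * complex_of_real (g x) =
        (\<Sum>\<^sub>\<infinity>n::int. complex_of_real (exp (- (real_of_int n)\<^sup>2)) * exp (\<i> * complex_of_real (real_of_int n * x)))"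
  shows "complex_of_real (torus_inner f (\<lambda>x. cos (real n * x)) + torus_inner g (\<lambda>x. sin (real n * x))) +
      \<i> * complex_of_real (torus_inner g (\<lambda>x. cos (real n * x)) - torus_inner f (\<lambda>x. sin (real n * x))) =
      of_real (2 * pi * exp (- (real n)\<^sup>2))"
proof -
  let ?c = "\<lambda>x. cos (real n * x)" and ?s = "\<lambda>x. sin (real n * x)"
  let ?e = "\<lambda>j x. exp (\<i> * complex_of_real (real_of_int j * x))"
  let ?b = "\<lambda>k. exp (- (real_of_int (int_decode k))\<^sup>2)"
  let ?S = "{0..2 * pi}"
  note f_int = L2_torus_product_integrable[OF f trig_L2_torus(1)[of n]] L2_torus_product_integrable[OF f trig_L2_torus(2)[of n]]
  note g_int = L2_torus_product_integrable[OF g trig_L2_torus(1)[of n]] L2_torus_product_integrable[OF g trig_L2_torus(2)[of n]]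
  \<comment> \<open>The \<open>k\<close>-th term of the series, already multiplied by exp (- i n x).
    Its modulus does not depend on \<open>x\<close>.\<close>
  define t where "t k x = complex_of_real (?b k) * ?e (int_decode k - int n) x" for k x
  have [measurable]: "t k \<in> borel_measurable borel" for k
    unfolding t_def by (intro borel_measurable_continuous_onI continuous_intros)
  have norm_t: "norm (t k x) = ?b k" for k x
    by (simp add: t_def norm_mult)
  have sumt: "summable (\<lambda>k. norm (t k x))" for x
    unfolding norm_t by (rule summable_exp_minus_square_int_decode)
  \<comment> \<open>The unordered sum over the integers is rewritten as an ordinary series, the form
    in which sum and integral can be exchanged; absolute convergence makes the enumeration
    immaterial.\<close>
  have series': "(\<Sum>\<^sub>\<infinity>j::int. complex_of_real (exp (- (real_of_int j)\<^sup>2)) * ?e j x) = (\<Sum>k. complex_of_real (?b k) * ?e (int_decode k) x)" for x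
  proof -
    let ?t = "\<lambda>j. complex_of_real (exp (- (real_of_int j)\<^sup>2)) * ?e j x"
    have "summable (\<lambda>k. norm (?t (int_decode k)))"
      using summable_exp_minus_square_int_decode by (simp add: norm_mult)
    then have "(\<lambda>k. ?t (int_decode k)) summable_on UNIV"
      by (rule norm_summable_imp_summable_on)
    from has_sum_imp_sums[OF has_sum_infsum[OF this]]
    have "(\<Sum>\<^sub>\<infinity>k. ?t (int_decode k)) = (\<Sum>k. ?t (int_decode k))"
      by (simp add: sums_iff)
    moreover have "(\<Sum>\<^sub>\<infinity>k. ?t (int_decode k)) = (\<Sum>\<^sub>\<infinity>j. ?t j)"
      by (rule infsum_reindex_bij_betw[OF bij_int_decode])
    ultimately show ?thesis by simp
  qed
  have e_n: "?e (- int n) x = of_real (?c x) - \<i> * of_real (?s x)" for x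
  proof -
    have "real_of_int (- int n) * x = - (real n * x)" by simp
    then show ?thesis unfolding cis_conv_exp[symmetric] by (simp add: complex_eq_iff)
  qed
  note f_int' = f_int[THEN set_integrable_complex_of_real] and g_int' = g_int[THEN set_integrable_complex_of_real]
  note split_outer = set_integral_add(2)[OF set_integral_add(1)[OF f_int'(1) g_int'(2)]
      set_integrable_mult_right[OF set_integral_diff(1)[OF g_int'(1) f_int'(2)]]]
    and split_inner = set_integral_add(2)[OF f_int'(1) g_int'(2)] set_integral_diff(2)[OF g_int'(1) f_int'(2)]
  have e_add: "?e (j - int n) x = ?e j x * ?e (- int n) x" for j x
    by (simp add: algebra_simps flip: exp_add)
  have "complex_of_real (torus_inner f ?c + torus_inner g ?s) + \<i> * complex_of_real (torus_inner g ?c - torus_inner f ?s) =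
      (LINT x:?S|lborel. complex_of_real (f x * ?c x) + of_real (g x * ?s x) + \<i> * (of_real (g x * ?c x) - of_real (f x * ?s x)))"
    by (simp only: split_outer split_inner set_integral_mult_right set_integral_complex_of_real
          torus_inner_def of_real_add of_real_diff)
  also have "\<dots> = (LINT x:?S|lborel. (\<Sum>k. t k x))"
  proof (rule set_lebesgue_integral_cong_AE)
    show "AE x\<in>?S in lborel. of_real (f x * ?c x) + of_real (g x * ?s x) + \<i> * (of_real (g x * ?c x) - of_real (f x * ?s x)) = (\<Sum>k. t k x)"
      using series
    proof eventually_elim
      case (elim x)
      have "(\<Sum>k. t k x) = (\<Sum>k. complex_of_real (?b k) * ?e (int_decode k) x * ?e (- int n) x)"
        by (simp only: t_def e_add mult.assoc)
      also have "\<dots> = (\<Sum>k. complex_of_real (?b k) * ?e (int_decode k) x) * ?e (- int n) x"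
        by (rule suminf_mult2[symmetric], rule summable_norm_cancel)
           (simp add: norm_mult summable_exp_minus_square_int_decode)
      also have "\<dots> = (of_real (f x) + \<i> * of_real (g x)) * ?e (- int n) x"
        using elim series' by simp
      also have "\<dots> = of_real (f x * ?c x) + of_real (g x * ?s x) + \<i> * (of_real (g x * ?c x) - of_real (f x * ?s x))"
        unfolding e_n by (simp only: complex_eq_iff) simp
      finally show ?case by (simp only: simp_thms)
    qed
  qed (use f g in \<open>auto simp: L2_torus_def\<close>)
  also have "\<dots> = (\<integral>x. (\<Sum>k. indicator ?S x *\<^sub>R t k x) \<partial>lborel)"
    unfolding set_lebesgue_integral_def suminf_scaleR_right[OF summable_norm_cancel[OF sumt]] ..
  also have "\<dots> = (\<Sum>k. \<integral>x. indicator ?S x *\<^sub>R t k x \<partial>lborel)"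
  proof (rule integral_suminf)
    show "integrable lborel (\<lambda>x. indicat_real ?S x *\<^sub>R t k x)" for k
      unfolding t_def set_integrable_def[symmetric]
      by (intro borel_integrable_atLeastAtMost' continuous_intros)
    show "AE x in lborel. summable (\<lambda>k. norm (indicat_real ?S x *\<^sub>R t k x))"
      using sumt by (auto intro!: summable_mult)
    show "summable (\<lambda>k. \<integral>x. norm (indicat_real ?S x *\<^sub>R t k x) \<partial>lborel)"
      using summable_exp_minus_square_int_decode by (simp add: norm_t summable_mult)
  qed
  also have "\<dots> = (\<Sum>k. complex_of_real (?b k) * (if int_decode k = int n then 2 * pi else 0))"
  proof (rule suminf_cong)
    fix k
    have "(\<integral>x. indicator ?S x *\<^sub>R t k x \<partial>lborel) = of_real (?b k) * (LINT x:?S|lborel. ?e (int_decode k - int n) x)"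
      unfolding set_lebesgue_integral_def t_def mult_scaleR_right[symmetric] by (rule integral_mult_right_zero)
    then show "(\<integral>x. indicator ?S x *\<^sub>R t k x \<partial>lborel) = complex_of_real (?b k) * (if int_decode k = int n then 2 * pi else 0)"
      unfolding integral_exp_int_period by simp
  qed
  also have "\<dots> = (\<Sum>k\<in>{int_encode (int n)}. complex_of_real (?b k) * (if int_decode k = int n then 2 * pi else 0))"
    by (rule suminf_finite) (auto dest: arg_cong[of _ _ int_encode])
  finally show ?thesis by simp
qed

section \<open>Weighted expectations of Ito equations\<close>

context filtered_prob_space
begin

text \<open>Collects what Fubini's theorem needs for the product with a weight: joint measurability,
  and second moments bounded uniformly on bounded time intervals. As \<open>K\<close> is real, the
  bound is finite, and the field is square integrable on the product space.\<close>

definition L2_field :: "(real \<Rightarrow> 'a \<Rightarrow> real) \<Rightarrow> bool" where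
  "L2_field Y \<longleftrightarrow> (\<forall>T\<ge>0. (\<lambda>(s, \<omega>). Y s \<omega>) \<in> borel_measurable (restrict_space lborel {0..T} \<Otimes>\<^sub>M M) \<and>
     (\<exists>K::real. \<forall>s\<in>{0..T}. Y s \<in> borel_measurable M \<and> (\<integral>\<^sup>+\<omega>. ennreal ((Y s \<omega>)\<^sup>2) \<partial>M) \<le> ennreal K))"

end

context wiener_process
begin

text \<open>Weight and field are both square integrable on the product of the time interval with the
  probability space, so their product is integrable there and the order of integration is
  free.\<close>

lemma
  fixes \<theta> :: complex
  assumes Y: "L2_field Y" and T: "0 \<le> T" and t: "0 \<le> t"
  defines "Z \<equiv> exp_increment \<theta> 0 T"
  shows L2_field_pairing_integrable: "integrable M (\<lambda>\<omega>. Z \<omega> * of_real (Y t \<omega>))"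
    and L2_field_pairing_set_integrable: "set_integrable lborel {0..t} (\<lambda>s. \<integral>\<omega>. Z \<omega> * of_real (Y s \<omega>) \<partial>M)"
    and L2_field_pairing_integrable': "integrable M (\<lambda>\<omega>. Z \<omega> * of_real (LINT s:{0..t}|lborel. Y s \<omega>))"
    and L2_field_pairing_Fubini: "(\<integral>\<omega>. Z \<omega> * of_real (LINT s:{0..t}|lborel. Y s \<omega>) \<partial>M) =
      (LINT s:{0..t}|lborel. (\<integral>\<omega>. Z \<omega> * of_real (Y s \<omega>) \<partial>M))"
proof -
  define R where "R = restrict_space lborel {0..t}"
  have emeasure_R: "emeasure R (space R) = ennreal t"
    using t by (simp add: R_def space_restrict_space emeasure_restrict_space)
  then have "finite_measure R" by (intro finite_measureI) simp
  then interpret R: finite_measure R .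
  interpret P: pair_sigma_finite R M ..
  obtain K :: real where meas: "(\<lambda>(s, \<omega>). Y s \<omega>) \<in> borel_measurable (R \<Otimes>\<^sub>M M)"
    and Y_M: "\<And>s. s \<in> {0..t} \<Longrightarrow> Y s \<in> borel_measurable M"
    and K: "\<And>s. s \<in> {0..t} \<Longrightarrow> (\<integral>\<^sup>+\<omega>. ennreal ((Y s \<omega>)\<^sup>2) \<partial>M) \<le> ennreal K"
    using Y t unfolding L2_field_def R_def by meson
  have [measurable]: "(\<lambda>q. Y (fst q) (snd q)) \<in> borel_measurable (R \<Otimes>\<^sub>M M)"
    using meas by (simp add: split_beta')
  have Z_M [measurable]: "Z \<in> borel_measurable M"
    unfolding Z_def using T by (auto intro!: exp_increment_measurable)
  have Z_L2: "(\<integral>\<^sup>+\<omega>. ennreal ((norm (Z \<omega>))\<^sup>2) \<partial>M) < \<infinity>"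
    unfolding Z_def using T exp_increment_L2[of 0 T \<theta>] by simp
  show "integrable M (\<lambda>\<omega>. Z \<omega> * of_real (Y t \<omega>))"
    using K[of t] Y_M[of t] t by (intro integrable_L2_mult Z_L2) (auto intro: le_less_trans)
  have "(\<integral>\<^sup>+q. ennreal ((norm (Z (snd q)))\<^sup>2) \<partial>(R \<Otimes>\<^sub>M M)) = (\<integral>\<^sup>+s. (\<integral>\<^sup>+\<omega>. ennreal ((norm (Z \<omega>))\<^sup>2) \<partial>M) \<partial>R)"
    by (subst nn_integral_fst[symmetric]) auto
  also have "\<dots> < \<infinity>"
    using Z_L2 by (simp add: emeasure_R ennreal_mult_less_top)
  finally have Z_L2': "(\<integral>\<^sup>+q. ennreal ((norm (Z (snd q)))\<^sup>2) \<partial>(R \<Otimes>\<^sub>M M)) < \<infinity>" .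
  have "(\<integral>\<^sup>+q. ennreal ((Y (fst q) (snd q))\<^sup>2) \<partial>(R \<Otimes>\<^sub>M M)) = (\<integral>\<^sup>+s. (\<integral>\<^sup>+\<omega>. ennreal ((Y s \<omega>)\<^sup>2) \<partial>M) \<partial>R)"
    by (subst nn_integral_fst[symmetric]) auto
  also have "\<dots> \<le> (\<integral>\<^sup>+s. ennreal K \<partial>R)"
    by (intro nn_integral_mono K) (simp add: R_def space_restrict_space)
  also have "\<dots> < \<infinity>"
    by (simp add: emeasure_R ennreal_mult_less_top)
  finally have "integrable (R \<Otimes>\<^sub>M M) (\<lambda>q. Z (snd q) * of_real (Y (fst q) (snd q)))"
    by (intro integrable_L2_mult Z_L2') auto
  then have int: "integrable (R \<Otimes>\<^sub>M M) (case_prod (\<lambda>s \<omega>. Z \<omega> * of_real (Y s \<omega>)))"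
    by (simp add: split_beta')
  have LINT: "(\<integral>s. Z \<omega> * of_real (Y s \<omega>) \<partial>R) = Z \<omega> * of_real (LINT s:{0..t}|lborel. Y s \<omega>)" for \<omega>
    by (simp add: set_integral_eq_restrict_space R_def)
  show "set_integrable lborel {0..t} (\<lambda>s. \<integral>\<omega>. Z \<omega> * of_real (Y s \<omega>) \<partial>M)"
    using P.integrable_fst[OF int] by (simp add: R_def set_integrable_def integrable_restrict_space)
  show "integrable M (\<lambda>\<omega>. Z \<omega> * of_real (LINT s:{0..t}|lborel. Y s \<omega>))"
    using P.integrable_snd[OF int] unfolding LINT .
  show "(\<integral>\<omega>. Z \<omega> * of_real (LINT s:{0..t}|lborel. Y s \<omega>) \<partial>M) =
      (LINT s:{0..t}|lborel. (\<integral>\<omega>. Z \<omega> * of_real (Y s \<omega>) \<partial>M))"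
    using P.Fubini_integral[OF int] unfolding LINT by (simp add: set_integral_eq_restrict_space R_def)
qed

text \<open>Taking weighted expectations turns the stochastic integral into a drift with factor
  \<open>\<theta>\<close>. The assumptions on \<open>a\<close> and \<open>b\<close> have the shape
  that trigonometric test functions produce: the drift reproduces the same pairing, and the noise
  couples it to two others, \<open>P\<close> and \<open>Q\<close>.\<close>

lemma ito_equation_weighted:
  fixes \<theta> :: complex
  assumes eq: "ito_equation M F w v a b" and \<phi>: "\<phi> \<in> smooth_torus" and t: "0 \<le> t" "t \<le> T"
    and L2: "L2_field (\<lambda>s \<omega>. torus_inner (v s \<omega>) \<phi>)" "L2_field P" "L2_field Q"
    and a: "\<And>s \<omega>. 0 \<le> s \<Longrightarrow> \<omega> \<in> space M \<Longrightarrow> torus_inner (a s \<omega>) \<phi> = \<kappa> * torus_inner (v s \<omega>) \<phi>"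
    and b: "\<And>s \<omega>. 0 \<le> s \<Longrightarrow> \<omega> \<in> space M \<Longrightarrow> torus_inner (b s \<omega>) \<phi> = \<beta> * P s \<omega> + \<gamma> * Q s \<omega>"
  defines "Exp Y s \<equiv> \<integral>\<omega>. exp_increment \<theta> 0 T \<omega> * complex_of_real (Y s \<omega>) \<partial>M"
  shows "Exp (\<lambda>s \<omega>. torus_inner (v s \<omega>) \<phi>) t = Exp (\<lambda>s \<omega>. torus_inner (v s \<omega>) \<phi>) 0
     + of_real \<kappa> * (LINT s:{0..t}|lborel. Exp (\<lambda>s \<omega>. torus_inner (v s \<omega>) \<phi>) s)
     + \<theta> * (of_real \<beta> * (LINT s:{0..t}|lborel. Exp P s) + of_real \<gamma> * (LINT s:{0..t}|lborel. Exp Q s))"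
proof -
  let ?Z = "exp_increment \<theta> 0 T" and ?V = "\<lambda>s \<omega>. torus_inner (v s \<omega>) \<phi>"
  let ?b = "\<lambda>s \<omega>. torus_inner (b s \<omega>) \<phi>"
  define J where "J = ito_integral M F w t ?b"
  have T: "0 \<le> T" using t by simp
  have "ito_integrable M F w t ?b"
    using eq \<phi> t unfolding ito_equation_def by blast
  \<comment> \<open>\<open>ito_integral\<close> is an arbitrary choice; integrability guarantees
    that the chosen variable is a genuine version.\<close>
  then have J: "has_ito_integral M F w t ?b J"
    unfolding J_def ito_integral_def ito_integrable_def by (rule someI_ex)
  note int = L2_field_pairing_integrable[OF L2(1) T, of _ \<theta>] L2_field_pairing_integrable'[OF L2(1) T, of _ \<theta>]
    integrable_exp_increment_mult_ito[OF t J, of \<theta>]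
  have drift: "(LINT s:{0..t}|lborel. torus_inner (a s \<omega>) \<phi>) = \<kappa> * (LINT s:{0..t}|lborel. ?V s \<omega>)"
    if "\<omega> \<in> space M" for \<omega>
  proof -
    have "(LINT s:{0..t}|lborel. torus_inner (a s \<omega>) \<phi>) = (LINT s:{0..t}|lborel. \<kappa> * ?V s \<omega>)"
      by (rule set_lebesgue_integral_cong) (use that a in auto)
    then show ?thesis by simp
  qed
  let ?r = "\<lambda>\<omega>. ?Z \<omega> * of_real (?V 0 \<omega>) + of_real \<kappa> * (?Z \<omega> * of_real (LINT s:{0..t}|lborel. ?V s \<omega>)) + ?Z \<omega> * of_real (J \<omega>)"
  have "Exp ?V t = (\<integral>\<omega>. ?r \<omega> \<partial>M)"
    unfolding Exp_def
  proof (rule integral_cong_AE)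
    show "(\<lambda>\<omega>. ?Z \<omega> * complex_of_real (?V t \<omega>)) \<in> borel_measurable M"
      using int(1)[OF t(1)] by (rule borel_measurable_integrable)
    have "integrable M ?r"
      by (intro Bochner_Integration.integrable_add integrable_mult_right int order_refl t)
    then show "?r \<in> borel_measurable M" by (rule borel_measurable_integrable)
    have "AE \<omega> in M. ?V t \<omega> = ?V 0 \<omega> + (LINT s:{0..t}|lborel. torus_inner (a s \<omega>) \<phi>) + J \<omega>"
      using eq \<phi> t unfolding ito_equation_def J_def by blast
    then show "AE \<omega> in M. ?Z \<omega> * complex_of_real (?V t \<omega>) = ?r \<omega>"
      using AE_space
    proof eventually_elim
      case (elim \<omega>)
      then show ?case by (simp only: drift of_real_add of_real_mult distrib_left mult.left_commute)
    qed
  qed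
  also have "\<dots> = Exp ?V 0 + of_real \<kappa> * (\<integral>\<omega>. ?Z \<omega> * of_real (LINT s:{0..t}|lborel. ?V s \<omega>) \<partial>M) + (\<integral>\<omega>. ?Z \<omega> * of_real (J \<omega>) \<partial>M)"
    unfolding Exp_def integral_mult_right_zero[symmetric]
    by (simp only: Bochner_Integration.integral_add Bochner_Integration.integrable_add
          integrable_mult_right int order_refl t)
  also have "(\<integral>\<omega>. ?Z \<omega> * of_real (LINT s:{0..t}|lborel. ?V s \<omega>) \<partial>M) = (LINT s:{0..t}|lborel. Exp ?V s)"
    unfolding Exp_def by (rule L2_field_pairing_Fubini[OF L2(1) T t(1)])
  also have "(\<integral>\<omega>. ?Z \<omega> * of_real (J \<omega>) \<partial>M) = \<theta> * (LINT s:{0..t}|lborel. (\<integral>\<omega>. ?Z \<omega> * of_real (?b s \<omega>) \<partial>M))"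
    by (rule expectation_exp_increment_mult_ito[OF t J])
  also have "(LINT s:{0..t}|lborel. (\<integral>\<omega>. ?Z \<omega> * of_real (?b s \<omega>) \<partial>M)) =
      (LINT s:{0..t}|lborel. of_real \<beta> * Exp P s + of_real \<gamma> * Exp Q s)"
  proof (rule set_lebesgue_integral_cong)
    show "\<forall>s. s \<in> {0..t} \<longrightarrow> (\<integral>\<omega>. ?Z \<omega> * of_real (?b s \<omega>) \<partial>M) = of_real \<beta> * Exp P s + of_real \<gamma> * Exp Q s"
    proof safe
      fix s assume "s \<in> {0..t}"
      then have s: "0 \<le> s" by simp
      note PQ = L2_field_pairing_integrable[OF L2(2) T s, of \<theta>] L2_field_pairing_integrable[OF L2(3) T s, of \<theta>]
      have "(\<integral>\<omega>. ?Z \<omega> * of_real (?b s \<omega>) \<partial>M) =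
          (\<integral>\<omega>. of_real \<beta> * (?Z \<omega> * of_real (P s \<omega>)) + of_real \<gamma> * (?Z \<omega> * of_real (Q s \<omega>)) \<partial>M)"
        using b[OF s] by (intro Bochner_Integration.integral_cong refl) (simp add: algebra_simps)
      also have "\<dots> = of_real \<beta> * Exp P s + of_real \<gamma> * Exp Q s"
        unfolding Exp_def integral_mult_right_zero[symmetric]
        by (intro Bochner_Integration.integral_add integrable_mult_right PQ)
      finally show "(\<integral>\<omega>. ?Z \<omega> * of_real (?b s \<omega>) \<partial>M) = of_real \<beta> * Exp P s + of_real \<gamma> * Exp Q s" .
    qed
  qed simp
  also have "\<dots> = of_real \<beta> * (LINT s:{0..t}|lborel. Exp P s) + of_real \<gamma> * (LINT s:{0..t}|lborel. Exp Q s)"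
    unfolding Exp_def set_integral_mult_right[symmetric]
    by (intro set_integral_add(2) set_integrable_mult_right L2_field_pairing_set_integrable L2 T t)
  finally show ?thesis .
qed

end

section \<open>Fourier modes of the solution\<close>

lemma torus_inner_weak_deriv_1_combination:
  assumes "f \<in> sobolev_torus 2" "g \<in> sobolev_torus 2"
  shows "torus_inner (\<lambda>x. a * weak_deriv 1 f x + b * weak_deriv 1 g x) (\<lambda>x. cos (real n * x)) =
      (a * real n) * torus_inner f (\<lambda>x. sin (real n * x)) + (b * real n) * torus_inner g (\<lambda>x. sin (real n * x))"
    and "torus_inner (\<lambda>x. a * weak_deriv 1 f x + b * weak_deriv 1 g x) (\<lambda>x. sin (real n * x)) =
      (- a * real n) * torus_inner f (\<lambda>x. cos (real n * x)) + (- b * real n) * torus_inner g (\<lambda>x. cos (real n * x))"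
  using assms
  by (simp_all add: torus_inner_linear_combination trig_L2_torus weak_deriv_L2[of _ 2]
      torus_inner_weak_deriv_1_cos[unfolded One_nat_def] torus_inner_weak_deriv_1_sin[unfolded One_nat_def])

text \<open>The pair \<open>G\<close>, \<open>H\<close> arises from \<open>x\<close>,
  \<open>y\<close> by a rotation combined with a dilation. The inverse is the transpose divided by
  the determinant \<open>a\<^sup>2 + b\<^sup>2\<close>.\<close>

lemma rotation_components_measurable:
  fixes x y :: "'b \<Rightarrow> real"
  assumes G: "G \<in> borel_measurable N" "H \<in> borel_measurable N" and ab: "a\<^sup>2 + b\<^sup>2 \<noteq> 0"
    and eq: "\<And>q. q \<in> space N \<Longrightarrow> G q = a * x q - b * y q" "\<And>q. q \<in> space N \<Longrightarrow> H q = b * x q + a * y q"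
  shows "x \<in> borel_measurable N" "y \<in> borel_measurable N"
proof -
  have "(\<lambda>q. (a * G q + b * H q) / (a\<^sup>2 + b\<^sup>2)) \<in> borel_measurable N"
      "(\<lambda>q. (a * H q - b * G q) / (a\<^sup>2 + b\<^sup>2)) \<in> borel_measurable N"
    using G by measurable
  moreover have "(a * G q + b * H q) / (a\<^sup>2 + b\<^sup>2) = x q" "(a * H q - b * G q) / (a\<^sup>2 + b\<^sup>2) = y q"
    if "q \<in> space N" for q
  proof -
    have "a * G q + b * H q = x q * (a\<^sup>2 + b\<^sup>2)" "a * H q - b * G q = y q * (a\<^sup>2 + b\<^sup>2)"
      unfolding eq(1)[OF that] eq(2)[OF that] by (simp_all add: algebra_simps power2_eq_square)
    then show "(a * G q + b * H q) / (a\<^sup>2 + b\<^sup>2) = x q" "(a * H q - b * G q) / (a\<^sup>2 + b\<^sup>2) = y q"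
      using ab by simp_all
  qed
  ultimately show "x \<in> borel_measurable N" "y \<in> borel_measurable N"
    by (simp_all cong: measurable_cong)
qed

text \<open>By Cauchy-Schwarz each pairing is dominated pointwise by the supremum over time of the
  norm, whose second moment is finite and does not depend on \<open>s\<close>.\<close>

lemma in_L2_C_sobolev_pairing_bound:
  assumes v: "in_L2_C_sobolev M 0 T v" and \<phi>: "\<phi> \<in> smooth_torus"
    and meas: "\<And>s. s \<in> {0..T} \<Longrightarrow> (\<lambda>\<omega>. torus_inner (v s \<omega>) \<phi>) \<in> borel_measurable M"
  shows "\<exists>K::real. \<forall>s\<in>{0..T}. (\<integral>\<^sup>+\<omega>. ennreal ((torus_inner (v s \<omega>) \<phi>)\<^sup>2) \<partial>M) \<le> ennreal K"
proof -
  let ?S = "\<integral>\<^sup>+\<omega>. (SUP t\<in>{0..T}. ennreal ((sobolev_norm 0 (v t \<omega>))\<^sup>2)) \<partial>M"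
  have S: "?S < \<infinity>" using v by (simp add: in_L2_C_sobolev_def)
  \<comment> \<open>Adding 1 keeps \<open>c\<close> positive when \<open>\<phi>\<close> has norm 0,
    so that division by it is allowed.\<close>
  define c where "c = (L2_torus_norm \<phi>)\<^sup>2 + 1"
  have c: "0 < c" unfolding c_def by (simp add: add_nonneg_pos)
  have "(\<integral>\<^sup>+\<omega>. ennreal ((torus_inner (v s \<omega>) \<phi>)\<^sup>2) \<partial>M) \<le> ennreal (c * enn2real ?S)" if s: "s \<in> {0..T}" for s
  proof -
    have [measurable]: "(\<lambda>\<omega>. torus_inner (v s \<omega>) \<phi>) \<in> borel_measurable M" by (rule meas[OF s])
    \<comment> \<open>The constant is taken out of the integral of the pairing, which is measurable,
      rather than out of the integral of an uncountable supremum, whose measurability is not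
      assumed.\<close>
    have "(\<integral>\<^sup>+\<omega>. ennreal ((torus_inner (v s \<omega>) \<phi>)\<^sup>2) \<partial>M) = (\<integral>\<^sup>+\<omega>. ennreal c * ennreal ((torus_inner (v s \<omega>) \<phi>)\<^sup>2 / c) \<partial>M)"
      using c by (simp flip: ennreal_mult)
    also have "\<dots> = ennreal c * (\<integral>\<^sup>+\<omega>. ennreal ((torus_inner (v s \<omega>) \<phi>)\<^sup>2 / c) \<partial>M)"
      by (rule nn_integral_cmult) simp
    also have "\<dots> \<le> ennreal c * ?S"
    proof (intro mult_left_mono nn_integral_mono)
      fix \<omega> assume \<omega>: "\<omega> \<in> space M"
      have "v s \<omega> \<in> sobolev_torus 0"
        using v s \<omega> by (simp add: in_L2_C_sobolev_def)
      from power_mono[OF torus_inner_le_sobolev_norm[OF this \<phi>] abs_ge_zero, of 2]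
      have "(torus_inner (v s \<omega>) \<phi>)\<^sup>2 \<le> (sobolev_norm 0 (v s \<omega>))\<^sup>2 * (L2_torus_norm \<phi>)\<^sup>2"
        by (simp add: power_mult_distrib)
      also have "\<dots> \<le> (sobolev_norm 0 (v s \<omega>))\<^sup>2 * c"
        by (intro mult_left_mono) (auto simp: c_def)
      finally have "(torus_inner (v s \<omega>) \<phi>)\<^sup>2 / c \<le> (sobolev_norm 0 (v s \<omega>))\<^sup>2"
        using c by (simp add: divide_le_eq)
      then have "ennreal ((torus_inner (v s \<omega>) \<phi>)\<^sup>2 / c) \<le> ennreal ((sobolev_norm 0 (v s \<omega>))\<^sup>2)"
        by (rule ennreal_leI)
      also have "\<dots> \<le> (SUP t\<in>{0..T}. ennreal ((sobolev_norm 0 (v t \<omega>))\<^sup>2))"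
        by (rule SUP_upper[OF s])
      finally show "ennreal ((torus_inner (v s \<omega>) \<phi>)\<^sup>2 / c) \<le> \<dots>" .
    qed simp
    also have "\<dots> = ennreal (c * enn2real ?S)"
      using S c by (simp add: ennreal_mult)
    finally show ?thesis .
  qed
  then show ?thesis by blast
qed

context wiener_process
begin

lemma
  assumes sol: "system_solution l \<mu> M F w u1 u2" and "0 \<le> s" "\<omega> \<in> space M"
  shows system_solution_sobolev: "u1 s \<omega> \<in> sobolev_torus m" "u2 s \<omega> \<in> sobolev_torus m"
proof -
  \<comment> \<open>The solution property speaks of positive horizons only, and \<open>s\<close> may
    be 0.\<close>
  have "in_L2_C_sobolev M m (s + 1) u1" "in_L2_C_sobolev M m (s + 1) u2"
    using sol assms(2) unfolding system_solution_def by auto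
  then show "u1 s \<omega> \<in> sobolev_torus m" "u2 s \<omega> \<in> sobolev_torus m"
    using assms(2,3) by (auto simp: in_L2_C_sobolev_def)
qed

lemma
  assumes sol: "system_solution l \<mu> M F w u1 u2" and s: "0 \<le> s" "\<omega> \<in> space M"
  shows system_solution_noise_cos:
      "torus_inner (\<lambda>x. l * weak_deriv 1 (u1 s \<omega>) x - \<mu> * weak_deriv 1 (u2 s \<omega>) x) (\<lambda>x. cos (real n * x)) =
        (l * real n) * torus_inner (u1 s \<omega>) (\<lambda>x. sin (real n * x)) + (- \<mu> * real n) * torus_inner (u2 s \<omega>) (\<lambda>x. sin (real n * x))"
      "torus_inner (\<lambda>x. \<mu> * weak_deriv 1 (u1 s \<omega>) x + l * weak_deriv 1 (u2 s \<omega>) x) (\<lambda>x. cos (real n * x)) =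
        (\<mu> * real n) * torus_inner (u1 s \<omega>) (\<lambda>x. sin (real n * x)) + (l * real n) * torus_inner (u2 s \<omega>) (\<lambda>x. sin (real n * x))"
    and system_solution_noise_sin:
      "torus_inner (\<lambda>x. l * weak_deriv 1 (u1 s \<omega>) x - \<mu> * weak_deriv 1 (u2 s \<omega>) x) (\<lambda>x. sin (real n * x)) =
        (- l * real n) * torus_inner (u1 s \<omega>) (\<lambda>x. cos (real n * x)) + (\<mu> * real n) * torus_inner (u2 s \<omega>) (\<lambda>x. cos (real n * x))"
      "torus_inner (\<lambda>x. \<mu> * weak_deriv 1 (u1 s \<omega>) x + l * weak_deriv 1 (u2 s \<omega>) x) (\<lambda>x. sin (real n * x)) =
        (- \<mu> * real n) * torus_inner (u1 s \<omega>) (\<lambda>x. cos (real n * x)) + (- l * real n) * torus_inner (u2 s \<omega>) (\<lambda>x. cos (real n * x))"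
  using torus_inner_weak_deriv_1_combination[OF system_solution_sobolev[OF sol s, of 2], of l "- \<mu>" n]
    torus_inner_weak_deriv_1_combination[OF system_solution_sobolev[OF sol s, of 2], of \<mu> l n]
  by simp_all

text \<open>
  Joint measurability of the Fourier modes is read off the integrands of the two Ito integrals,
  which are progressive and from which, as \<open>l\<^sup>2 + \<mu>\<^sup>2 \<noteq> 0\<close>, the modes can be recovered.
\<close>

lemma system_solution_L2_field:
  assumes sol: "system_solution l \<mu> M F w u1 u2" and \<mu>: "\<mu> \<noteq> 0" and n: "0 < n"
  shows "L2_field (\<lambda>s \<omega>. torus_inner (u1 s \<omega>) (\<lambda>x. cos (real n * x)))"
    and "L2_field (\<lambda>s \<omega>. torus_inner (u1 s \<omega>) (\<lambda>x. sin (real n * x)))"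
    and "L2_field (\<lambda>s \<omega>. torus_inner (u2 s \<omega>) (\<lambda>x. cos (real n * x)))"
    and "L2_field (\<lambda>s \<omega>. torus_inner (u2 s \<omega>) (\<lambda>x. sin (real n * x)))"
proof -
  let ?c = "\<lambda>x. cos (real n * x)" and ?s = "\<lambda>x. sin (real n * x)"
  let ?b1 = "\<lambda>s \<omega> x. l * weak_deriv 1 (u1 s \<omega>) x - \<mu> * weak_deriv 1 (u2 s \<omega>) x"
  let ?b2 = "\<lambda>s \<omega> x. \<mu> * weak_deriv 1 (u1 s \<omega>) x + l * weak_deriv 1 (u2 s \<omega>) x"
  have adapted: "adapted_field F u1" "adapted_field F u2"
    and L2C: "\<And>T. 0 < T \<Longrightarrow> in_L2_C_sobolev M 0 T u1" "\<And>T. 0 < T \<Longrightarrow> in_L2_C_sobolev M 0 T u2"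
    and eq: "ito_equation M F w u1 (\<lambda>t \<omega>. weak_deriv 2 (u1 t \<omega>)) ?b1"
      "ito_equation M F w u2 (\<lambda>t \<omega>. weak_deriv 2 (u2 t \<omega>)) ?b2"
    using sol unfolding system_solution_def by blast+
  have meas: "(\<lambda>\<omega>. torus_inner (v s \<omega>) \<phi>) \<in> borel_measurable M"
    if "v = u1 \<or> v = u2" "\<phi> \<in> smooth_torus" "0 \<le> s" for v \<phi> s
  proof -
    have "adapted_field F v" using that(1) adapted by auto
    then have "(\<lambda>\<omega>. torus_inner (v s \<omega>) \<phi>) \<in> borel_measurable (F s)"
      using that(2,3) smooth_torus_subset_L2_torus unfolding adapted_field_def by blast
    then show ?thesis by (rule measurable_F_M)
  qed
  have bound: "\<exists>K::real. \<forall>s\<in>{0..T}. (\<lambda>\<omega>. torus_inner (v s \<omega>) \<phi>) \<in> borel_measurable M \<and>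
      (\<integral>\<^sup>+\<omega>. ennreal ((torus_inner (v s \<omega>) \<phi>)\<^sup>2) \<partial>M) \<le> ennreal K"
    if v: "v = u1 \<or> v = u2" and \<phi>: "\<phi> \<in> smooth_torus" and T: "0 \<le> T" for v \<phi> T
  proof -
    have "0 < T + 1" using T by simp
    then have "in_L2_C_sobolev M 0 (T + 1) v"
      using v L2C by metis
    from in_L2_C_sobolev_pairing_bound[OF this \<phi>] meas[OF v \<phi>]
    obtain K :: real where "\<forall>s\<in>{0..T + 1}. (\<integral>\<^sup>+\<omega>. ennreal ((torus_inner (v s \<omega>) \<phi>)\<^sup>2) \<partial>M) \<le> ennreal K"
      by auto
    then show ?thesis using meas[OF v \<phi>] T by (intro exI[of _ K]) auto
  qed
  have noise: "(\<lambda>(s, \<omega>). torus_inner (b s \<omega>) \<phi>) \<in> borel_measurable (restrict_space lborel {0..T} \<Otimes>\<^sub>M M)"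
    if b: "b = ?b1 \<or> b = ?b2" and \<phi>: "\<phi> \<in> smooth_torus" and T: "0 \<le> T" for b \<phi> T
  proof -
    have "ito_integrable M F w T (\<lambda>s \<omega>. torus_inner (b s \<omega>) \<phi>)"
      using b eq \<phi> T unfolding ito_equation_def by blast
    then have "progressive F T (\<lambda>s \<omega>. torus_inner (b s \<omega>) \<phi>)"
      unfolding ito_integrable_def has_ito_integral_def by blast
    then show ?thesis using T by (rule progressive_measurable)
  qed
  \<comment> \<open>The determinants of the two rotations to be inverted below.\<close>
  have nz: "(l * real n)\<^sup>2 + (\<mu> * real n)\<^sup>2 \<noteq> 0" "(- l * real n)\<^sup>2 + (- \<mu> * real n)\<^sup>2 \<noteq> 0"
    using \<mu> n by (simp_all add: sum_power2_eq_zero_iff)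
  have joint: "(\<lambda>(s, \<omega>). torus_inner (u1 s \<omega>) ?s) \<in> borel_measurable (restrict_space lborel {0..T} \<Otimes>\<^sub>M M)"
    "(\<lambda>(s, \<omega>). torus_inner (u2 s \<omega>) ?s) \<in> borel_measurable (restrict_space lborel {0..T} \<Otimes>\<^sub>M M)"
    "(\<lambda>(s, \<omega>). torus_inner (u1 s \<omega>) ?c) \<in> borel_measurable (restrict_space lborel {0..T} \<Otimes>\<^sub>M M)"
    "(\<lambda>(s, \<omega>). torus_inner (u2 s \<omega>) ?c) \<in> borel_measurable (restrict_space lborel {0..T} \<Otimes>\<^sub>M M)"
    if T: "0 \<le> T" for T
  proof -
    let ?N = "restrict_space lborel {0..T} \<Otimes>\<^sub>M M"
    have space: "0 \<le> s" "\<omega> \<in> space M" if "(s, \<omega>) \<in> space ?N" for s \<omega>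
      using that by (auto simp: space_pair_measure space_restrict_space)
    \<comment> \<open>Differentiation exchanges cosine and sine: the noise tested with the cosine
      yields the sine modes, and conversely.\<close>
    note cos = noise[OF disjI1[OF refl] cos_smooth_torus[of n] T] noise[OF disjI2[OF refl] cos_smooth_torus[of n] T]
      and sin = noise[OF disjI1[OF refl] sin_smooth_torus[of n] T] noise[OF disjI2[OF refl] sin_smooth_torus[of n] T]
    show "(\<lambda>(s, \<omega>). torus_inner (u1 s \<omega>) ?s) \<in> borel_measurable ?N" "(\<lambda>(s, \<omega>). torus_inner (u2 s \<omega>) ?s) \<in> borel_measurable ?N"
    proof -
      have "(\<lambda>(s, \<omega>). torus_inner (?b1 s \<omega>) ?c) q =
            (l * real n) * (\<lambda>(s, \<omega>). torus_inner (u1 s \<omega>) ?s) q - (\<mu> * real n) * (\<lambda>(s, \<omega>). torus_inner (u2 s \<omega>) ?s) q \<and>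
          (\<lambda>(s, \<omega>). torus_inner (?b2 s \<omega>) ?c) q =
            (\<mu> * real n) * (\<lambda>(s, \<omega>). torus_inner (u1 s \<omega>) ?s) q + (l * real n) * (\<lambda>(s, \<omega>). torus_inner (u2 s \<omega>) ?s) q"
        if "q \<in> space ?N" for q
      proof (cases q)
        case (Pair s \<omega>)
        with that space have "0 \<le> s" "\<omega> \<in> space M" by auto
        from system_solution_noise_cos[OF sol this] Pair show ?thesis by simp
      qed
      then show "(\<lambda>(s, \<omega>). torus_inner (u1 s \<omega>) ?s) \<in> borel_measurable ?N" "(\<lambda>(s, \<omega>). torus_inner (u2 s \<omega>) ?s) \<in> borel_measurable ?N"
        using rotation_components_measurable[OF cos nz(1)] by blast+
    qed
    show "(\<lambda>(s, \<omega>). torus_inner (u1 s \<omega>) ?c) \<in> borel_measurable ?N" "(\<lambda>(s, \<omega>). torus_inner (u2 s \<omega>) ?c) \<in> borel_measurable ?N"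
    proof -
      have "(\<lambda>(s, \<omega>). torus_inner (?b1 s \<omega>) ?s) q =
            (- l * real n) * (\<lambda>(s, \<omega>). torus_inner (u1 s \<omega>) ?c) q - (- \<mu> * real n) * (\<lambda>(s, \<omega>). torus_inner (u2 s \<omega>) ?c) q \<and>
          (\<lambda>(s, \<omega>). torus_inner (?b2 s \<omega>) ?s) q =
            (- \<mu> * real n) * (\<lambda>(s, \<omega>). torus_inner (u1 s \<omega>) ?c) q + (- l * real n) * (\<lambda>(s, \<omega>). torus_inner (u2 s \<omega>) ?c) q"
        if "q \<in> space ?N" for q
      proof (cases q)
        case (Pair s \<omega>)
        with that space have "0 \<le> s" "\<omega> \<in> space M" by auto
        from system_solution_noise_sin[OF sol this] Pair show ?thesis by simp
      qed
      then show "(\<lambda>(s, \<omega>). torus_inner (u1 s \<omega>) ?c) \<in> borel_measurable ?N" "(\<lambda>(s, \<omega>). torus_inner (u2 s \<omega>) ?c) \<in> borel_measurable ?N"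
        using rotation_components_measurable[OF sin nz(2)] by blast+
    qed
  qed
  show "L2_field (\<lambda>s \<omega>. torus_inner (u1 s \<omega>) ?c)" "L2_field (\<lambda>s \<omega>. torus_inner (u1 s \<omega>) ?s)"
    "L2_field (\<lambda>s \<omega>. torus_inner (u2 s \<omega>) ?c)" "L2_field (\<lambda>s \<omega>. torus_inner (u2 s \<omega>) ?s)"
    unfolding L2_field_def using joint bound cos_smooth_torus[of n] sin_smooth_torus[of n] by blast+
qed

text \<open>The integral of (u1 + i u2) exp (- i n x) over a period, spelled out through real
  pairings because measurability and the equations are given for those.\<close>

definition fourier_mode :: "(real \<Rightarrow> 'a \<Rightarrow> real \<Rightarrow> real) \<Rightarrow> (real \<Rightarrow> 'a \<Rightarrow> real \<Rightarrow> real) \<Rightarrow> nat \<Rightarrow> real \<Rightarrow> 'a \<Rightarrow> complex" where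
  "fourier_mode u1 u2 n s \<omega> =
     of_real (torus_inner (u1 s \<omega>) (\<lambda>x. cos (real n * x)) + torus_inner (u2 s \<omega>) (\<lambda>x. sin (real n * x))) +
     \<i> * of_real (torus_inner (u2 s \<omega>) (\<lambda>x. cos (real n * x)) - torus_inner (u1 s \<omega>) (\<lambda>x. sin (real n * x)))"

text \<open>The four real pairings obey a coupled linear system of integral equations. The
  combination forming the mode is an eigenvector: it satisfies a scalar equation by itself, with the
  eigenvalue in the exponent.\<close>

lemma
  fixes \<theta> :: complex
  assumes sol: "system_solution l \<mu> M F w u1 u2" and \<mu>: "\<mu> \<noteq> 0" and n: "0 < n" and T: "0 \<le> T"
  defines "Z \<equiv> exp_increment \<theta> 0 T"
  shows integrable_exp_increment_mult_mode: "integrable M (\<lambda>\<omega>. Z \<omega> * fourier_mode u1 u2 n T \<omega>)"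
    and expectation_exp_increment_mult_mode:
      "(\<integral>\<omega>. Z \<omega> * fourier_mode u1 u2 n T \<omega> \<partial>M) = of_real (2 * pi * exp (- (real n)\<^sup>2)) * (\<integral>\<omega>. Z \<omega> \<partial>M) *
        exp ((- of_real ((real n)\<^sup>2) + \<theta> * of_real (real n) * (\<i> * of_real l - of_real \<mu>)) * of_real T)"
proof -
  let ?c = "\<lambda>x. cos (real n * x)" and ?s = "\<lambda>x. sin (real n * x)"
  let ?A = "\<lambda>s \<omega>. torus_inner (u1 s \<omega>) ?c" and ?B = "\<lambda>s \<omega>. torus_inner (u1 s \<omega>) ?s"
    and ?C = "\<lambda>s \<omega>. torus_inner (u2 s \<omega>) ?c" and ?D = "\<lambda>s \<omega>. torus_inner (u2 s \<omega>) ?s"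
  define E where "E Y s = (\<integral>\<omega>. Z \<omega> * complex_of_real (Y s \<omega>) \<partial>M)" for Y and s :: real
  \<comment> \<open>As the weight is complex, the values of \<open>E\<close> are complex too;
    \<open>m\<close> is a linear combination of them and not a splitting into real and imaginary
    part.\<close>
  define m where "m s = (E ?A s + E ?D s) + \<i> * (E ?C s - E ?B s)" for s
  note L2 = system_solution_L2_field[OF sol \<mu> n]
  note int = L2[THEN L2_field_pairing_integrable[OF _ T, where \<theta> = \<theta>], folded Z_def]
  have mode_eq: "Z \<omega> * fourier_mode u1 u2 n s \<omega> =
      (Z \<omega> * of_real (?A s \<omega>) + Z \<omega> * of_real (?D s \<omega>)) + \<i> * (Z \<omega> * of_real (?C s \<omega>) - Z \<omega> * of_real (?B s \<omega>))" for s \<omega>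
    by (simp add: fourier_mode_def algebra_simps)
  have mode_int: "integrable M (\<lambda>\<omega>. Z \<omega> * fourier_mode u1 u2 n s \<omega>)"
    and mode_E: "(\<integral>\<omega>. Z \<omega> * fourier_mode u1 u2 n s \<omega> \<partial>M) = m s" if "0 \<le> s" for s
    using int[OF that] unfolding mode_eq E_def m_def
    by (simp_all only: Bochner_Integration.integrable_add Bochner_Integration.integrable_diff integrable_mult_right
         Bochner_Integration.integral_add Bochner_Integration.integral_diff integral_mult_right_zero)
  show "integrable M (\<lambda>\<omega>. Z \<omega> * fourier_mode u1 u2 n T \<omega>)" using mode_int T by simp
  have eq: "ito_equation M F w u1 (\<lambda>t \<omega>. weak_deriv 2 (u1 t \<omega>)) (\<lambda>t \<omega> x. l * weak_deriv 1 (u1 t \<omega>) x - \<mu> * weak_deriv 1 (u2 t \<omega>) x)"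
      "ito_equation M F w u2 (\<lambda>t \<omega>. weak_deriv 2 (u2 t \<omega>)) (\<lambda>t \<omega> x. \<mu> * weak_deriv 1 (u1 t \<omega>) x + l * weak_deriv 1 (u2 t \<omega>) x)"
    and init: "AE \<omega> in M. AE x in lborel.
        complex_of_real (u1 0 \<omega> x) + \<i> * complex_of_real (u2 0 \<omega> x) =
        (\<Sum>\<^sub>\<infinity>n::int. complex_of_real (exp (- (real_of_int n)\<^sup>2)) * exp (\<i> * complex_of_real (real_of_int n * x)))"
    using sol unfolding system_solution_def by blast+
  note sob = system_solution_sobolev[OF sol, where m = 2]
  note noise = system_solution_noise_cos[OF sol, where n = n] system_solution_noise_sin[OF sol, where n = n]
  note drift = torus_inner_weak_deriv_2_cos torus_inner_weak_deriv_2_sin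
  define I where "I Y t = (LINT s:{0..t}|lborel. E Y s)" for Y t
  have mode: "E ?A t = E ?A 0 + of_real (- (real n)\<^sup>2) * I ?A t + \<theta> * (of_real (l * real n) * I ?B t + of_real (- \<mu> * real n) * I ?D t)"
    "E ?B t = E ?B 0 + of_real (- (real n)\<^sup>2) * I ?B t + \<theta> * (of_real (- l * real n) * I ?A t + of_real (\<mu> * real n) * I ?C t)"
    "E ?C t = E ?C 0 + of_real (- (real n)\<^sup>2) * I ?C t + \<theta> * (of_real (\<mu> * real n) * I ?B t + of_real (l * real n) * I ?D t)"
    "E ?D t = E ?D 0 + of_real (- (real n)\<^sup>2) * I ?D t + \<theta> * (of_real (- \<mu> * real n) * I ?A t + of_real (- l * real n) * I ?C t)"
    if t: "t \<in> {0..T}" for t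
  proof -
    from t have t': "0 \<le> t" "t \<le> T" by auto
    show "E ?A t = E ?A 0 + of_real (- (real n)\<^sup>2) * I ?A t + \<theta> * (of_real (l * real n) * I ?B t + of_real (- \<mu> * real n) * I ?D t)"
      unfolding E_def I_def Z_def
      by (rule ito_equation_weighted[OF eq(1) cos_smooth_torus t' L2(1) L2(2) L2(4)]) (intro drift noise sob; assumption)+
    show "E ?B t = E ?B 0 + of_real (- (real n)\<^sup>2) * I ?B t + \<theta> * (of_real (- l * real n) * I ?A t + of_real (\<mu> * real n) * I ?C t)"
      unfolding E_def I_def Z_def
      by (rule ito_equation_weighted[OF eq(1) sin_smooth_torus t' L2(2) L2(1) L2(3)]) (intro drift noise sob; assumption)+
    show "E ?C t = E ?C 0 + of_real (- (real n)\<^sup>2) * I ?C t + \<theta> * (of_real (\<mu> * real n) * I ?B t + of_real (l * real n) * I ?D t)"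
      unfolding E_def I_def Z_def
      by (rule ito_equation_weighted[OF eq(2) cos_smooth_torus t' L2(3) L2(2) L2(4)]) (intro drift noise sob; assumption)+
    show "E ?D t = E ?D 0 + of_real (- (real n)\<^sup>2) * I ?D t + \<theta> * (of_real (- \<mu> * real n) * I ?A t + of_real (- l * real n) * I ?C t)"
      unfolding E_def I_def Z_def
      by (rule ito_equation_weighted[OF eq(2) sin_smooth_torus t' L2(4) L2(1) L2(3)]) (intro drift noise sob; assumption)+
  qed
  let ?\<Lambda> = "- of_real ((real n)\<^sup>2) + \<theta> * of_real (real n) * (\<i> * of_real l - of_real \<mu>)"
  have E_int: "set_integrable lborel {0..t} (E ?A)" "set_integrable lborel {0..t} (E ?B)"
    "set_integrable lborel {0..t} (E ?C)" "set_integrable lborel {0..t} (E ?D)" if "0 \<le> t" for t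
    using L2[THEN L2_field_pairing_set_integrable[OF _ T that, where \<theta> = \<theta>], folded Z_def] unfolding E_def .
  have m_int: "set_integrable lborel {0..t} m"
    and m_I: "(LINT s:{0..t}|lborel. m s) = (I ?A t + I ?D t) + \<i> * (I ?C t - I ?B t)" if "0 \<le> t" for t
    using E_int[OF that] unfolding m_def[abs_def] I_def
    by (simp_all only: set_integral_add set_integral_diff set_integrable_mult_right set_integral_mult_right)
  have "m T = m 0 * exp (?\<Lambda> * of_real T)"
  proof (rule linear_integral_equation_unique[OF T m_int[OF T]])
    fix t assume t: "t \<in> {0..T}"
    then have t': "0 \<le> t" by simp
    \<comment> \<open>In this combination the four noise terms recombine to \<open>\<theta>\<close>
      times \<open>n (\<i> l - \<mu>)\<close> times the integral of \<open>m\<close>.\<close>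
    show "m t = m 0 + ?\<Lambda> * (LINT s:{0..t}|lborel. m s)"
      unfolding m_I[OF t'] unfolding m_def mode[OF t] by (simp add: algebra_simps)
  qed
  \<comment> \<open>At time 0 the mode is almost surely a constant, so it leaves the
    expectation.\<close>
  moreover have "m 0 = of_real (2 * pi * exp (- (real n)\<^sup>2)) * (\<integral>\<omega>. Z \<omega> \<partial>M)"
  proof -
    have "m 0 = (\<integral>\<omega>. Z \<omega> * fourier_mode u1 u2 n 0 \<omega> \<partial>M)"
      using mode_E[of 0] by simp
    also have "\<dots> = (\<integral>\<omega>. of_real (2 * pi * exp (- (real n)\<^sup>2)) * Z \<omega> \<partial>M)"
    proof (rule integral_cong_AE)
      show "(\<lambda>\<omega>. Z \<omega> * fourier_mode u1 u2 n 0 \<omega>) \<in> borel_measurable M"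
        using mode_int[of 0] by (intro borel_measurable_integrable) simp
      show "(\<lambda>\<omega>. of_real (2 * pi * exp (- (real n)\<^sup>2)) * Z \<omega>) \<in> borel_measurable M"
        unfolding Z_def using T exp_increment_measurable[of 0 T \<theta>] by simp
      show "AE \<omega> in M. Z \<omega> * fourier_mode u1 u2 n 0 \<omega> = of_real (2 * pi * exp (- (real n)\<^sup>2)) * Z \<omega>"
        using init AE_space
      proof eventually_elim
        case (elim \<omega>)
        have "fourier_mode u1 u2 n 0 \<omega> = of_real (2 * pi * exp (- (real n)\<^sup>2))"
          unfolding fourier_mode_def
          by (rule gaussian_fourier_coefficient[OF sobolev_torus_L2[OF sob(1)[OF order_refl elim(2)]]
                sobolev_torus_L2[OF sob(2)[OF order_refl elim(2)]] elim(1)])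
        then show ?case by (simp only: mult.commute)
      qed
    qed
    also have "\<dots> = of_real (2 * pi * exp (- (real n)\<^sup>2)) * (\<integral>\<omega>. Z \<omega> \<partial>M)"
      by (rule integral_mult_right_zero)
    finally show ?thesis .
  qed
  ultimately show "(\<integral>\<omega>. Z \<omega> * fourier_mode u1 u2 n T \<omega> \<partial>M) = of_real (2 * pi * exp (- (real n)\<^sup>2)) * (\<integral>\<omega>. Z \<omega> \<partial>M) *
        exp (?\<Lambda> * of_real T)"
    using mode_E[OF T] by simp
qed

text \<open>The mode is a sum of four real pairings, each at most the norm of the pair times
  \<open>sqrt (2 * pi)\<close>. The crude factor 4 is harmless because it does not depend on
  \<open>n\<close>.\<close>

lemma norm_fourier_mode_le:
  assumes sol: "system_solution l \<mu> M F w u1 u2" and s: "0 \<le> s" "\<omega> \<in> space M"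
  shows "norm (fourier_mode u1 u2 n s \<omega>) \<le> 4 * sqrt (2 * pi) * L2_torus_norm_pair (u1 s \<omega>) (u2 s \<omega>)"
proof -
  let ?N = "L2_torus_norm_pair (u1 s \<omega>) (u2 s \<omega>)"
  have N: "L2_torus_norm (u1 s \<omega>) \<le> ?N" "L2_torus_norm (u2 s \<omega>) \<le> ?N"
    unfolding L2_torus_norm_pair_def by (simp_all add: real_le_rsqrt)
  have bound: "\<bar>torus_inner f \<phi>\<bar> \<le> ?N * sqrt (2 * pi)"
    if "f \<in> L2_torus" "L2_torus_norm f \<le> ?N" "\<phi> \<in> L2_torus" "L2_torus_norm \<phi> \<le> sqrt (2 * pi)" for f \<phi>
  proof -
    have "\<bar>torus_inner f \<phi>\<bar> \<le> L2_torus_norm f * L2_torus_norm \<phi>"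
      by (rule torus_Cauchy_Schwarz[OF that(1,3)])
    also have "\<dots> \<le> ?N * sqrt (2 * pi)"
      by (intro mult_mono that) (auto simp: L2_torus_norm_def L2_torus_norm_pair_def torus_inner_self_nonneg)
    finally show ?thesis .
  qed
  note u = system_solution_sobolev[OF sol s, of 0, THEN sobolev_torus_L2]
  note b = bound[OF u(1) N(1) trig_L2_torus(1) trig_norm_le(1), of n] bound[OF u(1) N(1) trig_L2_torus(2) trig_norm_le(2), of n]
    bound[OF u(2) N(2) trig_L2_torus(1) trig_norm_le(1), of n] bound[OF u(2) N(2) trig_L2_torus(2) trig_norm_le(2), of n]
  have "norm (fourier_mode u1 u2 n s \<omega>) \<le>
      \<bar>torus_inner (u1 s \<omega>) (\<lambda>x. cos (real n * x)) + torus_inner (u2 s \<omega>) (\<lambda>x. sin (real n * x))\<bar> +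
      \<bar>torus_inner (u2 s \<omega>) (\<lambda>x. cos (real n * x)) - torus_inner (u1 s \<omega>) (\<lambda>x. sin (real n * x))\<bar>"
    unfolding fourier_mode_def by (rule norm_triangle_le) (simp add: norm_mult del: of_real_add of_real_diff)
  moreover have "4 * sqrt (2 * pi) * ?N = 4 * (?N * sqrt (2 * pi))" by simp
  ultimately show ?thesis using b by linarith
qed

end

section \<open>Divergence of the moments\<close>

text \<open>
  Hoelder's inequality with the optimal constants replaced by the weaker ones of Young's inequality,
  which suffices since only the linear dependence on \<open>S\<close> matters.
\<close>

lemma (in prob_space) norm_expectation_mult_le_Young:
  fixes X Z :: "'a \<Rightarrow> complex"
  assumes [measurable]: "X \<in> borel_measurable M" "Z \<in> borel_measurable M"
    and int: "integrable M (\<lambda>\<omega>. Z \<omega> * X \<omega>)"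
    and pq: "1 < p" "1 < q" "1 / p + 1 / q = 1" and S: "0 < S" and \<kappa>: "0 < \<kappa>" and K: "0 \<le> K"
    and Z: "integrable M (\<lambda>\<omega>. norm (Z \<omega>) powr q)" "(\<integral>\<omega>. norm (Z \<omega>) powr q \<partial>M) = S powr q"
    and X: "(\<integral>\<^sup>+\<omega>. ennreal ((norm (X \<omega>) / \<kappa>) powr p) \<partial>M) \<le> ennreal K"
  shows "norm (\<integral>\<omega>. Z \<omega> * X \<omega> \<partial>M) \<le> \<kappa> * S * (1 / q + K / p)"
proof -
  have X_int: "integrable M (\<lambda>\<omega>. (norm (X \<omega>) / \<kappa>) powr p)"
    using X by (intro integrableI_bounded) (auto simp: le_less_trans)
  have "ennreal (\<integral>\<omega>. (norm (X \<omega>) / \<kappa>) powr p \<partial>M) \<le> ennreal K"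
    using X by (subst nn_integral_eq_integral[symmetric, OF X_int]) auto
  then have X_le: "(\<integral>\<omega>. (norm (X \<omega>) / \<kappa>) powr p \<partial>M) \<le> K"
    using K by (simp add: ennreal_le_iff)
  \<comment> \<open>Young's inequality is applied to \<open>norm (X \<omega>) / \<kappa>\<close> and
    \<open>norm (Z \<omega>) / S\<close>. Since \<open>S\<close> is the \<open>q\<close>-norm of
    \<open>Z\<close>, the second factor contributes exactly \<open>1 / q\<close> in
    expectation.\<close>
  let ?g = "\<lambda>\<omega>. \<kappa> * S * (norm (Z \<omega>) powr q / (S powr q * q) + (norm (X \<omega>) / \<kappa>) powr p / p)"
  have "norm (\<integral>\<omega>. Z \<omega> * X \<omega> \<partial>M) \<le> (\<integral>\<omega>. norm (Z \<omega> * X \<omega>) \<partial>M)"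
    by (rule integral_norm_bound)
  also have "\<dots> \<le> (\<integral>\<omega>. ?g \<omega> \<partial>M)"
  proof (rule integral_mono)
    show "integrable M (\<lambda>\<omega>. norm (Z \<omega> * X \<omega>))" using int by (rule integrable_norm)
    show "integrable M ?g" using X_int Z(1) by simp
    fix \<omega>
    have "norm (Z \<omega> * X \<omega>) = \<kappa> * S * ((norm (X \<omega>) / \<kappa>) * (norm (Z \<omega>) / S))"
      using S \<kappa> by (simp add: norm_mult)
    also have "\<dots> \<le> \<kappa> * S * ((norm (X \<omega>) / \<kappa>) powr p / p + (norm (Z \<omega>) / S) powr q / q)"
      using S \<kappa> pq by (intro mult_left_mono Youngs_inequality) auto
    also have "\<dots> = ?g \<omega>"
      using S by (simp add: powr_divide add.commute)
    finally show "norm (Z \<omega> * X \<omega>) \<le> ?g \<omega>" .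
  qed
  also have "\<dots> = \<kappa> * S * (1 / q + (\<integral>\<omega>. (norm (X \<omega>) / \<kappa>) powr p \<partial>M) / p)"
    using X_int Z S by simp
  also have "\<dots> \<le> \<kappa> * S * (1 / q + K / p)"
    using X_le S \<kappa> pq by (intro mult_left_mono add_left_mono divide_right_mono) auto
  finally show ?thesis .
qed

theorem lemma6p4:
  fixes M :: "'a measure" and F :: "real \<Rightarrow> 'a measure" and w :: "real \<Rightarrow> 'a \<Rightarrow> real"
    and u1 u2 :: "real \<Rightarrow> 'a \<Rightarrow> real \<Rightarrow> real"
    and l \<mu> p \<epsilon> t :: real
  assumes "wiener_process M F w"
    and "system_solution l \<mu> M F w u1 u2"
    and "p > 2"
    and "l\<^sup>2 + \<mu>\<^sup>2 < 2"
    and "\<epsilon> = l\<^sup>2 + (p - 1) * \<mu>\<^sup>2 - 2"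
    and "\<epsilon> > 0"
    and "t > 2 / \<epsilon>"
  shows "(\<integral>\<^sup>+\<omega>. ennreal (L2_torus_norm_pair (u1 t \<omega>) (u2 t \<omega>) powr p) \<partial>M) = \<infinity>"
proof (rule ccontr)
  let ?I = "\<integral>\<^sup>+\<omega>. ennreal (L2_torus_norm_pair (u1 t \<omega>) (u2 t \<omega>) powr p) \<partial>M"
  assume fin: "?I \<noteq> \<infinity>"
  interpret wiener_process M F w by fact
  note sol = assms(2)
  \<comment> \<open>If \<open>\<mu>\<close> were 0, then \<open>\<epsilon>\<close> would equal
    \<open>l\<^sup>2 - 2\<close>, which is negative.\<close>
  have \<mu>: "\<mu> \<noteq> 0" using assms(4-6) by auto
  have "0 < 2 / \<epsilon>" using assms(6) by simp
  then have t: "0 \<le> t" using assms(7) by linarith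
  have growth: "0 < \<epsilon> * t - 2" using assms(6,7) by (simp add: field_simps)
  define q where "q = p / (p - 1)"
  have pq: "1 < p" "1 < q" "1 / p + 1 / q = 1"
    using assms(3) unfolding q_def by (auto simp: field_simps)
  define \<kappa> where "\<kappa> = 4 * sqrt (2 * pi)"
  have \<kappa>: "0 < \<kappa>" by (simp add: \<kappa>_def)
  \<comment> \<open>The upper bound without its factor \<open>S\<close>; it is independent of
    \<open>n\<close>, as \<open>S\<close> will cancel against the same factor in the exact
    value.\<close>
  define C where "C = \<kappa> * (1 / q + enn2real ?I / p)"
  have bound: "2 * pi * exp ((real n)\<^sup>2 * (\<epsilon> * t - 2) / 2) \<le> C" if n: "0 < n" for n
  proof -
    define \<theta> where "\<theta> = Complex (- (p - 1) * real n * \<mu>) (- real n * l)"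
    \<comment> \<open>The \<open>q\<close>-norm of the weight: the \<open>q\<close>-th moment has
      \<open>q\<^sup>2\<close> in its exponent, and the \<open>q\<close>-th root removes one
      \<open>q\<close>.\<close>
    define S where "S = exp (q * (Re \<theta>)\<^sup>2 * t / 2)"
    let ?Z = "exp_increment \<theta> 0 t" and ?X = "fourier_mode u1 u2 n t"
    let ?\<Lambda> = "- of_real ((real n)\<^sup>2) + \<theta> * of_real (real n) * (\<i> * of_real l - of_real \<mu>)"
    have Z_M [measurable]: "?Z \<in> borel_measurable M"
      using t by (intro exp_increment_measurable) auto
    have ZX: "integrable M (\<lambda>\<omega>. ?Z \<omega> * ?X \<omega>)"
      by (rule integrable_exp_increment_mult_mode[OF sol \<mu> n t])
    \<comment> \<open>Measurability of the mode is recovered from that of the product, because the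
      weight never vanishes.\<close>
    have "(\<lambda>\<omega>. (?Z \<omega> * ?X \<omega>) / ?Z \<omega>) \<in> borel_measurable M"
      using borel_measurable_integrable[OF ZX] by measurable
    then have X_M: "?X \<in> borel_measurable M"
      by (simp add: exp_increment_def)
    have X_le: "(\<integral>\<^sup>+\<omega>. ennreal ((norm (?X \<omega>) / \<kappa>) powr p) \<partial>M) \<le> ennreal (enn2real ?I)"
    proof -
      have "(\<integral>\<^sup>+\<omega>. ennreal ((norm (?X \<omega>) / \<kappa>) powr p) \<partial>M) \<le> ?I"
      proof (intro nn_integral_mono ennreal_leI powr_mono2)
        fix \<omega> assume "\<omega> \<in> space M"
        from norm_fourier_mode_le[OF sol t this, of n]
        show "norm (?X \<omega>) / \<kappa> \<le> L2_torus_norm_pair (u1 t \<omega>) (u2 t \<omega>)"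
          using \<kappa> by (simp add: divide_le_eq \<kappa>_def mult.commute)
      qed (use pq \<kappa> in auto)
      with fin show ?thesis by (simp add: less_top)
    qed
    have S: "0 < S" by (simp add: S_def)
    have "(q * Re \<theta>)\<^sup>2 * (t - 0) / 2 = q * (q * (Re \<theta>)\<^sup>2 * t / 2)"
      by (simp add: power2_eq_square)
    then have Z_q: "(\<integral>\<omega>. norm (?Z \<omega>) powr q \<partial>M) = S powr q"
      using t by (simp only: expectation_norm_exp_increment_powr S_def) (simp add: powr_def)
    have "norm (\<integral>\<omega>. ?Z \<omega> * ?X \<omega> \<partial>M) \<le> \<kappa> * S * (1 / q + enn2real ?I / p)"
      using t by (intro norm_expectation_mult_le_Young X_M Z_M ZX pq S \<kappa> Z_q X_le
          integrable_norm_exp_increment_powr) auto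
    moreover have "norm (\<integral>\<omega>. ?Z \<omega> * ?X \<omega> \<partial>M) = S * (2 * pi * exp ((real n)\<^sup>2 * (\<epsilon> * t - 2) / 2))"
    proof -
      have re: "Re ?\<Lambda> = - (real n)\<^sup>2 + (real n)\<^sup>2 * ((p - 1) * \<mu>\<^sup>2 + l\<^sup>2)"
        by (simp add: \<theta>_def algebra_simps power2_eq_square)
      have q': "q * (Re \<theta>)\<^sup>2 = p * (p - 1) * (real n)\<^sup>2 * \<mu>\<^sup>2"
        using assms(3) by (simp add: \<theta>_def q_def power2_eq_square field_simps)
      have "norm (\<integral>\<omega>. ?Z \<omega> * ?X \<omega> \<partial>M) =
          2 * pi * exp (- (real n)\<^sup>2) * exp (((Re \<theta>)\<^sup>2 - (Im \<theta>)\<^sup>2) * (t - 0) / 2) * exp (Re ?\<Lambda> * t)"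
        unfolding expectation_exp_increment_mult_mode[OF sol \<mu> n t] norm_mult
          norm_expectation_exp_increment[OF order_refl t] norm_exp_complex_times_real norm_of_real
        by simp
      also have "\<dots> = 2 * pi * exp (- (real n)\<^sup>2 + ((Re \<theta>)\<^sup>2 - (Im \<theta>)\<^sup>2) * t / 2 + Re ?\<Lambda> * t)"
        by (simp only: exp_add mult.assoc diff_zero)
      \<comment> \<open>The terms in \<open>\<mu>\<^sup>2\<close> combine by
        \<open>(p - 1)\<^sup>2 + 2 * (p - 1) = p * (p - 1) + (p - 1)\<close>: the first part is the
        exponent of \<open>S\<close>, the second belongs to \<open>\<epsilon>\<close>. For
        \<open>l\<^sup>2\<close> the balance is \<open>2 - 1 = 1\<close>, the loss coming from the
        oscillation of the weight.\<close>
      also have "- (real n)\<^sup>2 + ((Re \<theta>)\<^sup>2 - (Im \<theta>)\<^sup>2) * t / 2 + Re ?\<Lambda> * t =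
          q * (Re \<theta>)\<^sup>2 * t / 2 + (real n)\<^sup>2 * (\<epsilon> * t - 2) / 2"
        unfolding re q' assms(5) by (simp add: \<theta>_def power2_eq_square field_simps)
      finally show ?thesis
        unfolding S_def exp_add by simp
    qed
    ultimately have "S * (2 * pi * exp ((real n)\<^sup>2 * (\<epsilon> * t - 2) / 2)) \<le> S * C"
      by (simp add: C_def mult_ac)
    then show ?thesis using S by simp
  qed
  \<comment> \<open>A linear lower bound on the exponential suffices. Passing to
    \<open>Suc n\<close> makes the frequency positive, as \<open>bound\<close> requires, and hence
    at most its own square.\<close>
  obtain n :: nat where n: "C / (\<epsilon> * t - 2) < real n" using reals_Archimedean2 by blast
  define k where "k = Suc n"
  have "C < real k * (\<epsilon> * t - 2)"
    using n growth by (simp add: k_def divide_less_eq algebra_simps)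
  also have "\<dots> \<le> (real k)\<^sup>2 * (\<epsilon> * t - 2)"
    using growth by (intro mult_right_mono) (auto simp: k_def power2_eq_square)
  also have "\<dots> \<le> 2 * (1 + (real k)\<^sup>2 * (\<epsilon> * t - 2) / 2)" by simp
  also have "\<dots> \<le> 2 * exp ((real k)\<^sup>2 * (\<epsilon> * t - 2) / 2)"
    by (intro mult_left_mono exp_ge_add_one_self) simp
  also have "\<dots> \<le> 2 * pi * exp ((real k)\<^sup>2 * (\<epsilon> * t - 2) / 2)"
    using pi_ge_two by (intro mult_right_mono) auto
  finally show False using bound[of k] by (simp add: k_def)
qed

end
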